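(* Let $(W,S)$ be a finite Coxeter system and let $I,J\subseteq S$ with $|I|=|J|=|S|-1$. Let $H$ be a graph isomorphic to the $(I,J;W,S)$-graph (a generalised face-incidence graph), and let $t$ be the number of vertices in the larger part of its bipartition. Then $\mathrm{ex}(n,H)=O(n^{2-c})$ as $n\to\infty$, where $c=\frac{v(H)-t-1}{e(H)-t}$.
   Context: A (finite) Coxeter system $(W,S)$ consists of a finite group $W$ and a finite generating set $S=\{s_1,\dots,s_m\}$ such that $W$ has presentation $\langle s_1,\dots,s_m \mid (s_is_j)^{m_{ij}}=1\rangle$ with $m_{ii}=1$ and $m_{ij}=m_{ji}\ge 2$ integers for $i\ne j$. For $I\subseteq S$, $W_I$ denotes the subgroup of $W$ generated by $I$ (a parabolic subgroup) and $W/W_I$ the set of left cosets of $W_I$. For $I,J\subseteq S$, the $(I,J;W,S)$-graph is the bipartite graph with parts $W/W_I$ and $W/W_J$ in which $wW_I$ and $wW_J$ are adjacent for every $w\in W$ (i.e., two cosets are adjacent iff they intersect). A generalised face-incidence graph is a graph isomorphic to an $(I,J;W,S)$-graph with $|I|=|J|=|S|-1$. $\mathrm{ex}(n,H)$ is the largest number of edges in an $n$-vertex graph containing no subgraph isomorphic to $H$; $v(H),e(H)$ are the numbers of vertices and edges of $H$. *)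

theory Defs
  imports
    Complex_Main
    "HOL-Algebra.Generated_Groups"
    "HOL-Algebra.Left_Coset"
    "HOL-Library.Landau_Symbols"
    "HOL-Library.Ramsey"
begin

section \<open>Group presentations\<close>

text \<open>
  Words over \<open>S\<close> and its formal inverses: the letter \<open>(s, True)\<close> stands for \<open>s\<close>
  and \<open>(s, False)\<close> for its formal inverse.
\<close>

type_synonym 'a word = "('a \<times> bool) list"

definition words :: "'a set \<Rightarrow> 'a word set" where
  "words S = lists (S \<times> UNIV)"

definition eval_word :: "('a, 'b) monoid_scheme \<Rightarrow> 'a word \<Rightarrow> 'a" where
  "eval_word G w =
     foldr (\<lambda>(s, b) x. (if b then s else inv\<^bsub>G\<^esub> s) \<otimes>\<^bsub>G\<^esub> x) w \<one>\<^bsub>G\<^esub>"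

text \<open>
  The classes of this relation on words are the elements of the abstract group
  \<open>\<langle>S | R\<rangle>\<close>, i.e. of the free group on \<open>S\<close> modulo the normal closure of \<open>R\<close>.
\<close>

inductive pres_eq :: "'a set \<Rightarrow> 'a word set \<Rightarrow> 'a word \<Rightarrow> 'a word \<Rightarrow> bool"
  for S :: "'a set" and R :: "'a word set" where
  refl: "u \<in> words S \<Longrightarrow> pres_eq S R u u"
| sym: "pres_eq S R u v \<Longrightarrow> pres_eq S R v u"
| trans: "pres_eq S R u v \<Longrightarrow> pres_eq S R v w \<Longrightarrow> pres_eq S R u w"
| cancel: "u \<in> words S \<Longrightarrow> v \<in> words S \<Longrightarrow> s \<in> S \<Longrightarrow>
    pres_eq S R (u @ [(s, b), (s, \<not> b)] @ v) (u @ v)"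
| relator: "u \<in> words S \<Longrightarrow> v \<in> words S \<Longrightarrow> r \<in> R \<Longrightarrow> pres_eq S R (u @ r @ v) (u @ v)"

text \<open>
  The canonical map from \<open>\<langle>S | R\<rangle>\<close> to \<open>G\<close> is a well-defined bijection.
\<close>

definition has_presentation :: "('a, 'b) monoid_scheme \<Rightarrow> 'a set \<Rightarrow> 'a word set \<Rightarrow> bool" where
  "has_presentation G S R \<longleftrightarrow>
     S \<subseteq> carrier G \<and> R \<subseteq> words S \<and> generate G S = carrier G \<and>
     (\<forall>u \<in> words S. \<forall>v \<in> words S. eval_word G u = eval_word G v \<longleftrightarrow> pres_eq S R u v)"

section \<open>Finite Coxeter systems\<close>

definition coxeter_relators :: "'a set \<Rightarrow> ('a \<Rightarrow> 'a \<Rightarrow> nat) \<Rightarrow> 'a word set" where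
  "coxeter_relators S m =
     {concat (replicate (m s t) [(s, True), (t, True)]) | s t. s \<in> S \<and> t \<in> S}"

definition finite_coxeter_system :: "('a, 'b) monoid_scheme \<Rightarrow> 'a set \<Rightarrow> bool" where
  "finite_coxeter_system W S \<longleftrightarrow>
     group W \<and> finite (carrier W) \<and>
     (\<exists>m :: 'a \<Rightarrow> 'a \<Rightarrow> nat.
        (\<forall>s \<in> S. m s s = 1) \<and>
        (\<forall>s \<in> S. \<forall>t \<in> S. s \<noteq> t \<longrightarrow> m s t = m t s \<and> m s t \<ge> 2) \<and>
        has_presentation W S (coxeter_relators S m))"

section \<open>Finite simple graphs\<close>

record 'v ugraph =
  verts :: "'v set"
  edges :: "'v set set"

definition is_ugraph :: "'v ugraph \<Rightarrow> bool" where
  "is_ugraph G \<longleftrightarrow> finite (verts G) \<and> edges G \<subseteq> [verts G]\<^bsup>2\<^esup>"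

definition ugraph_iso :: "'u ugraph \<Rightarrow> 'v ugraph \<Rightarrow> bool" where
  "ugraph_iso G H \<longleftrightarrow>
     (\<exists>f. bij_betw f (verts G) (verts H) \<and> edges H = (\<lambda>e. f ` e) ` edges G)"

definition subgraph :: "'v ugraph \<Rightarrow> 'v ugraph \<Rightarrow> bool" where
  "subgraph F G \<longleftrightarrow> is_ugraph F \<and> verts F \<subseteq> verts G \<and> edges F \<subseteq> edges G"

definition contains_copy :: "'u ugraph \<Rightarrow> 'v ugraph \<Rightarrow> bool" where
  "contains_copy G H \<longleftrightarrow> (\<exists>F. subgraph F G \<and> ugraph_iso F H)"

text \<open>
  Host graphs on vertices of type \<^typ>\<open>nat\<close> represent all finite graphs up to isomorphism.
  For \<open>H\<close> with at least one edge the set below is nonempty (the edgeless graph is \<open>H\<close>-free).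
\<close>

definition ex :: "nat \<Rightarrow> 'v ugraph \<Rightarrow> nat" where
  "ex n H = Max {card (edges G) | G :: nat ugraph.
     is_ugraph G \<and> card (verts G) = n \<and> \<not> contains_copy G H}"

section \<open>The graph of a pair of parabolic subgroups\<close>

text \<open>
  The parts are kept disjoint by tagging, since for \<open>I = J\<close> both consist of the same cosets.
\<close>

definition coxeter_graph ::
  "('a, 'b) monoid_scheme \<Rightarrow> 'a set \<Rightarrow> 'a set \<Rightarrow> ('a set + 'a set) ugraph" where
  "coxeter_graph W I J =
     \<lparr> verts = (lcosets\<^bsub>W\<^esub> (generate W I)) <+> (lcosets\<^bsub>W\<^esub> (generate W J)),
       edges = {{Inl (w <#\<^bsub>W\<^esub> generate W I), Inr (w <#\<^bsub>W\<^esub> generate W J)} | w. w \<in> carrier W} \<rparr>"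

end

theory Submission
  imports Defs "HOL-Library.Sublist" "HOL-Analysis.Convex"
begin

text \<open>
  Let \<open>H\<close> be the incidence graph of the cosets of \<open>W\<^sub>I\<close> and \<open>W\<^sub>J\<close>. Every generator \<open>s\<close> reflects \<open>H\<close>
  and separates the elements of \<open>W\<close>, which label the edges, into two half-spaces; vertices meeting
  both half-spaces are fixed by \<open>s\<close>. By Cauchy-Schwarz the number of homomorphisms of \<open>H\<close> under any
  constraint is at most the geometric mean of the numbers for the two folded constraints. Folding
  repeatedly towards the base chamber turns a single edge into all of \<open>H\<close>, which yields Sidorenko's
  inequality for \<open>H\<close>, and turns the constraint that two vertices of one part coincide into the
  constraint that the whole part is mapped to one vertex. In an almost regular host of \<open>m\<close> vertices
  with average degree \<open>d\<close> there are at most about \<open>m d\<^sup>t\<close> homomorphisms of the last kind, whereas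
  Sidorenko's inequality provides about \<open>m\<^sup>v (d / m)\<^sup>e\<close> homomorphisms; if no homomorphism into a
  bipartite host is injective, comparing the two numbers bounds \<open>d\<close>.
\<close>

section \<open>Half-spaces of a Coxeter system\<close>

text \<open>Each fold costs a square, so percolating from a coinciding pair to a whole part compares
  a huge power of a count. The loss is only a constant: if no homomorphism is injective, some pair
  of vertices coincides in a fixed fraction of all homomorphisms, and a fixed power of a fixed
  fraction is again a fixed fraction. The exponent must therefore depend on the coset graph alone,
  never on the host, which is why it is quantified outside \<open>Z\<close> and \<open>E\<close>.
  The host is made bipartite to force the coinciding pair into one part. Maximality of
  \<open>I\<close> and \<open>J\<close> enters there too: a pair can be folded to the cosets of
  \<open>\<one>\<close> and of the single missing generator \<open>s0\<close>, and this seed grows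
  to the entire part. Sidorenko's inequality suffers no loss, because edges are counted through
  group elements, so that the sizes of the two folds of \<open>F\<close> average exactly to the size
  of \<open>F\<close>. The half-spaces come straight from the presentation: parities of wall
  crossings are unchanged by every relator, which replaces the geometric representation.\<close>

context group
begin

text \<open>\<open>par r w\<close>: the gallery from the base chamber described by \<open>w\<close> crosses the wall of the
  reflection \<open>r\<close> an odd number of times (the letters are meant to be involutions).\<close>

fun par :: "'a \<Rightarrow> 'a word \<Rightarrow> bool" where
  "par r [] = False"
| "par r ((s, b) # w) = ((s = r) \<noteq> par (s \<otimes> r \<otimes> s) w)"

lemma eval_word_Nil [simp]: "eval_word G [] = \<one>"
  by (simp add: eval_word_def)

lemma eval_word_Cons:
  "eval_word G ((s, b) # w) = (if b then s else inv s) \<otimes> eval_word G w"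
  by (simp add: eval_word_def)

lemma words_simps [simp]:
  "[] \<in> words S"
  "p # w \<in> words S \<longleftrightarrow> fst p \<in> S \<and> w \<in> words S"
  "u @ v \<in> words S \<longleftrightarrow> u \<in> words S \<and> v \<in> words S"
  by (auto simp: words_def mem_Times_iff)

lemma eval_word_closed [simp]:
  "S \<subseteq> carrier G \<Longrightarrow> w \<in> words S \<Longrightarrow> eval_word G w \<in> carrier G"
  by (induction w) (auto simp: eval_word_Cons split_paired_all)

lemma eval_word_append:
  "S \<subseteq> carrier G \<Longrightarrow> u \<in> words S \<Longrightarrow> v \<in> words S \<Longrightarrow>
    eval_word G (u @ v) = eval_word G u \<otimes> eval_word G v"
proof (induction u)
  case Nil
  then show ?case by simp
next
  case (Cons p u)
  obtain s b where p: "p = (s, b)" by fastforce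
  from Cons.prems p have "s \<in> carrier G" by auto
  with Cons p show ?case by (simp add: eval_word_Cons m_assoc)
qed

end

locale involution_gens = group G for G (structure) +
  fixes S :: "'a set"
  assumes gens_closed: "S \<subseteq> carrier G"
    and gens_sq: "s \<in> S \<Longrightarrow> s \<otimes> s = \<one>"
begin

lemma gen_closed [simp]: "s \<in> S \<Longrightarrow> s \<in> carrier G"
  using gens_closed by auto

lemma inv_gen [simp]: "s \<in> S \<Longrightarrow> inv s = s"
  by (simp add: inv_equality gens_sq)

lemma gen_cancel [simp]: "s \<in> S \<Longrightarrow> x \<in> carrier G \<Longrightarrow> s \<otimes> (s \<otimes> x) = x"
  by (simp add: m_assoc[symmetric] gens_sq)

lemma gen_cancel_right [simp]: "s \<in> S \<Longrightarrow> x \<in> carrier G \<Longrightarrow> x \<otimes> s \<otimes> s = x"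
  by (simp add: m_assoc gens_sq)

text \<open>Seen from the chamber to which \<open>u\<close> leads, the wall of \<open>r\<close>
  becomes the wall of \<open>r\<close> conjugated by the inverse of \<open>u\<close>; the recursion
  of \<open>par\<close> performs this conjugation one letter at a time.\<close>

lemma par_append:
  assumes "u \<in> words S" "v \<in> words S" "r \<in> carrier G"
  shows "par r (u @ v) = (par r u \<noteq> par (inv (eval_word G u) \<otimes> r \<otimes> eval_word G u) v)"
  using assms
proof (induction u arbitrary: r)
  case Nil
  then show ?case by simp
next
  case (Cons p u)
  obtain s b where p: "p = (s, b)" by fastforce
  from Cons.prems p have s: "s \<in> S" by auto
  have u: "eval_word G u \<in> carrier G" using Cons.prems gens_closed by auto
  have "inv (eval_word G u) \<otimes> (s \<otimes> r \<otimes> s) \<otimes> eval_word G u =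
      inv (s \<otimes> eval_word G u) \<otimes> r \<otimes> (s \<otimes> eval_word G u)"
    using s u Cons.prems by (simp add: inv_mult_group m_assoc)
  moreover have "eval_word G (p # u) = s \<otimes> eval_word G u"
    using s p by (simp add: eval_word_Cons)
  moreover have "s \<otimes> r \<otimes> s \<in> carrier G" using s Cons.prems by auto
  ultimately show ?case using Cons.IH[of "s \<otimes> r \<otimes> s"] Cons.prems p by auto
qed

lemma par_two: "s \<in> S \<Longrightarrow> t \<in> S \<Longrightarrow> r \<in> carrier G \<Longrightarrow>
    par r [(s, b), (t, b')] = ((r = s) \<noteq> (r = s \<otimes> t \<otimes> s))"
proof -
  assume a: "s \<in> S" "t \<in> S" "r \<in> carrier G"
  have "t = s \<otimes> r \<otimes> s \<longleftrightarrow> r = s \<otimes> t \<otimes> s"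
    using a by (metis gen_cancel gen_cancel_right gen_closed m_assoc m_closed)
  then show ?thesis using a by auto
qed

lemma eval_alternating:
  assumes "s \<in> S" "t \<in> S"
  shows "eval_word G (concat (replicate k [(s, True), (t, True)])) = (s \<otimes> t) [^] k"
proof (induction k)
  case 0
  then show ?case by simp
next
  case (Suc k)
  have st: "s \<otimes> t \<in> carrier G" using assms by simp
  have "eval_word G (concat (replicate (Suc k) [(s, True), (t, True)])) =
      s \<otimes> t \<otimes> (s \<otimes> t) [^] k"
    using Suc assms by (simp add: eval_word_Cons m_assoc)
  then show ?case by (simp only: nat_pow_Suc2[OF st])
qed

text \<open>With \<open>x = s t\<close> the reflections crossed along the word \<open>(s t)\<^sup>k\<close> are
  \<open>x\<^sup>j s\<close> for \<open>j < 2 k\<close>; if \<open>x\<^sup>k = 1\<close>, each of them is crossed an even number of times.\<close>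

lemma par_alternating:
  assumes s: "s \<in> S" and t: "t \<in> S" and r: "r \<in> carrier G"
  shows "par r (concat (replicate k [(s, True), (t, True)])) =
     odd (card {j. j < 2 * k \<and> r = (s \<otimes> t) [^] j \<otimes> s})"
proof -
  define x where "x = s \<otimes> t"
  have x: "x \<in> carrier G" "inv x = t \<otimes> s"
    using s t by (simp_all add: x_def inv_mult_group)
  let ?w = "\<lambda>k. concat (replicate k [(s, True), (t, True)])"
  have w: "?w k \<in> words S" for k using s t by (induction k) auto
  have ev: "eval_word G (?w k) = x [^] k" for k
    using s t by (simp add: x_def eval_alternating)
  \<comment> \<open>Dihedral relation: conjugation by \<open>s\<close> inverts \<open>x\<close>.
    Hence conjugating \<open>s\<close> by \<open>x [^] k\<close> gives
    \<open>x [^] (2 * k) \<otimes> s\<close>, and the two letters that follow \<open>?w k\<close>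
    contribute the indices \<open>2 * k\<close> and \<open>2 * k + 1\<close>.\<close>
  have sx: "s \<otimes> inv (x [^] k) = x [^] k \<otimes> s" for k :: nat
  proof (induction k)
    case 0
    then show ?case using s by simp
  next
    case (Suc k)
    have "s \<otimes> inv (x [^] Suc k) = s \<otimes> inv x \<otimes> inv (x [^] k)"
      using s x(1) by (simp add: inv_mult_group m_assoc)
    also have "s \<otimes> inv x = x \<otimes> s" unfolding x(2) using s t by (simp add: x_def m_assoc)
    also have "(x \<otimes> s) \<otimes> inv (x [^] k) = x \<otimes> (s \<otimes> inv (x [^] k))"
      using s x(1) by (simp add: m_assoc)
    also have "\<dots> = x \<otimes> x [^] k \<otimes> s"
      unfolding Suc using s x(1) by (simp add: m_assoc)
    also have "\<dots> = x [^] Suc k \<otimes> s" by (simp only: nat_pow_Suc2[OF x(1)])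
    finally show ?case .
  qed
  have conj: "inv (x [^] k) \<otimes> r \<otimes> x [^] k = y \<longleftrightarrow> r = x [^] k \<otimes> y \<otimes> inv (x [^] k)"
    if "y \<in> carrier G" for y and k :: nat
  proof -
    have "inv (x [^] k) \<otimes> r \<otimes> x [^] k = y \<longleftrightarrow> y = inv (x [^] k) \<otimes> r \<otimes> x [^] k" by auto
    also have "\<dots> \<longleftrightarrow> r \<otimes> x [^] k = x [^] k \<otimes> y"
      using that r x(1) by (subst m_assoc) (auto simp: inv_solve_left)
    also have "\<dots> \<longleftrightarrow> r = x [^] k \<otimes> y \<otimes> inv (x [^] k)"
      using that r x(1) by (subst inv_solve_right) auto
    finally show ?thesis .
  qed
  have "par r (?w k) = odd (card {j. j < 2 * k \<and> r = x [^] j \<otimes> s})"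
  proof (induction k)
    case 0
    then show ?case by simp
  next
    case (Suc k)
    let ?r = "inv (x [^] k) \<otimes> r \<otimes> x [^] k"
    have r': "?r \<in> carrier G" using r x by auto
    have "?w (Suc k) = ?w k @ [(s, True), (t, True)]"
      by (simp only: replicate_Suc[of k] replicate_append_same[symmetric] concat_append concat.simps append_Nil2)
    then have "par r (?w (Suc k)) = (par r (?w k) \<noteq> par ?r [(s, True), (t, True)])"
      using par_append[OF w, of "[(s, True), (t, True)]" r k] s t r by (simp only: ev) simp
    also have "par ?r [(s, True), (t, True)] = ((?r = s) \<noteq> (?r = x \<otimes> s))"
      using par_two[OF s t r'] by (simp only: x_def)
    also have "(?r = s) = (r = x [^] (2 * k) \<otimes> s)"
    proof -
      have "x [^] k \<otimes> s \<otimes> inv (x [^] k) = x [^] k \<otimes> (x [^] k \<otimes> s)"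
        using s x(1) by (simp add: m_assoc sx)
      also have "\<dots> = x [^] (2 * k) \<otimes> s"
        using s x(1) by (simp add: m_assoc[symmetric] nat_pow_mult mult_2)
      finally show ?thesis using s by (subst conj) auto
    qed
    also have "(?r = x \<otimes> s) = (r = x [^] Suc (2 * k) \<otimes> s)"
    proof -
      have "x [^] k \<otimes> (x \<otimes> s) \<otimes> inv (x [^] k) = x [^] k \<otimes> x \<otimes> (s \<otimes> inv (x [^] k))"
        using s x(1) by (simp add: m_assoc)
      also have "\<dots> = x [^] Suc k \<otimes> x [^] k \<otimes> s" using s x(1) by (simp add: m_assoc sx)
      also have "x [^] Suc k \<otimes> x [^] k = x [^] Suc (2 * k)"
        using x(1) by (simp only: nat_pow_mult mult_2 add_Suc)
      finally show ?thesis using s x(1) by (subst conj) (auto simp del: nat_pow_Suc)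
    qed
    finally have "par r (?w (Suc k)) =
      (odd (card {j. j < 2 * k \<and> r = x [^] j \<otimes> s}) \<noteq>
        ((r = x [^] (2 * k) \<otimes> s) \<noteq> (r = x [^] Suc (2 * k) \<otimes> s)))"
      by (simp only: Suc.IH)
    moreover have "{j. j < 2 * Suc k \<and> r = x [^] j \<otimes> s} =
       {j. j < 2 * k \<and> r = x [^] j \<otimes> s} \<union>
        ((if r = x [^] (2 * k) \<otimes> s then {2 * k} else {}) \<union>
         (if r = x [^] Suc (2 * k) \<otimes> s then {Suc (2 * k)} else {}))"
      by (auto simp: less_Suc_eq simp del: nat_pow_Suc)
    moreover have "card \<dots> = card {j. j < 2 * k \<and> r = x [^] j \<otimes> s} +
        ((if r = x [^] (2 * k) \<otimes> s then 1 else 0) + (if r = x [^] Suc (2 * k) \<otimes> s then 1 else 0))"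
      by (subst card_Un_disjoint) (auto simp del: nat_pow_Suc)
    ultimately show ?case by (simp del: nat_pow_Suc)
  qed
  then show ?thesis by (simp add: x_def)
qed

text \<open>Shifting the index by \<open>k\<close> pairs off the crossings counted in
  \<open>par_alternating\<close>.\<close>

lemma par_relator:
  assumes "s \<in> S" "t \<in> S" "r \<in> carrier G" and one: "(s \<otimes> t) [^] k = \<one>"
  shows "\<not> par r (concat (replicate k [(s, True), (t, True)]))"
proof -
  let ?A = "{j. j < k \<and> r = (s \<otimes> t) [^] j \<otimes> s}"
  have sh: "(s \<otimes> t) [^] (j + k) = (s \<otimes> t) [^] j" for j :: nat
    using assms by (simp add: nat_pow_mult[symmetric])
  have "{j. j < 2 * k \<and> r = (s \<otimes> t) [^] j \<otimes> s} = ?A \<union> (\<lambda>j. j + k) ` ?A"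
  proof (intro Set.set_eqI iffI)
    fix j assume j: "j \<in> {j. j < 2 * k \<and> r = (s \<otimes> t) [^] j \<otimes> s}"
    show "j \<in> ?A \<union> (\<lambda>j. j + k) ` ?A"
    proof (cases "j < k")
      case False
      then have "j - k \<in> ?A" using j sh[of "j - k"] by auto
      then show ?thesis using False by (intro UnI2 image_eqI[of _ _ "j - k"]) auto
    qed (use j in auto)
  qed (auto simp: sh)
  moreover have "card (?A \<union> (\<lambda>j. j + k) ` ?A) = card ?A + card ?A"
    by (subst card_Un_disjoint) (auto simp: card_image)
  ultimately show ?thesis using par_alternating[OF assms(1-3), of k] by simp
qed

end

lemma (in group) generate_words:
  assumes "S \<subseteq> carrier G" "g \<in> generate G S"
  obtains u where "u \<in> words S" "eval_word G u = g"
  using assms(2)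
proof (induction g arbitrary: thesis rule: generate.induct)
  case one
  show ?case by (rule one[of "[]"]) simp_all
next
  case (incl s)
  show ?case using assms(1) incl(1) by (intro incl(2)[of "[(s, True)]"]) (auto simp: eval_word_Cons)
next
  case (inv s)
  show ?case using assms(1) inv(1) by (intro inv(2)[of "[(s, False)]"]) (auto simp: eval_word_Cons)
next
  case (eng g h)
  obtain u where u: "u \<in> words S" "eval_word G u = g" by (rule eng.IH(1))
  obtain v where v: "v \<in> words S" "eval_word G v = h" by (rule eng.IH(2))
  show ?case using u v assms(1) by (intro eng.prems[of "u @ v"]) (simp_all add: eval_word_append)
qed

text \<open>\<open>neg s w\<close> says that the wall of the generator \<open>s\<close> separates the chamber \<open>w\<close> from
  the base chamber; \<open>neg_step\<close> says that an edge of the Cayley graph crosses this wall only if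
  it is flipped by \<open>s\<close>.\<close>

locale coxeter_halves = involution_gens G S for G (structure) and S +
  fixes neg :: "'a \<Rightarrow> 'a \<Rightarrow> bool"
  assumes fin: "finite (carrier G)"
    and gen: "generate G S = carrier G"
    and neg_one: "s \<in> S \<Longrightarrow> \<not> neg s \<one>"
    and neg_step: "s \<in> S \<Longrightarrow> t \<in> S \<Longrightarrow> w \<in> carrier G \<Longrightarrow>
      neg s (w \<otimes> t) \<noteq> neg s w \<longleftrightarrow> w \<otimes> t = s \<otimes> w"

text \<open>The parity of crossings is a function of words. It descends to the group because words
  of equal value are related by \<open>pres_eq\<close>, and no rule of \<open>pres_eq\<close>
  changes a parity; this is where the completeness of the Coxeter relators enters.\<close>

lemma finite_coxeter_system_halves:
  fixes G (structure)
  assumes "finite_coxeter_system G S"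
  obtains neg where "coxeter_halves G S neg"
proof -
  interpret group G using assms by (simp add: finite_coxeter_system_def)
  obtain m where m: "\<And>s. s \<in> S \<Longrightarrow> m s s = 1"
    and pres: "has_presentation G S (coxeter_relators S m)"
    using assms unfolding finite_coxeter_system_def by blast
  let ?R = "coxeter_relators S m"
  have SG: "S \<subseteq> carrier G" and gen: "generate G S = carrier G"
    and eq: "\<And>u v. u \<in> words S \<Longrightarrow> v \<in> words S \<Longrightarrow>
        eval_word G u = eval_word G v \<longleftrightarrow> pres_eq S ?R u v"
    using pres unfolding has_presentation_def by auto
  have rel_words: "concat (replicate k [(s, True), (t, True)]) \<in> words S"
    if "s \<in> S" "t \<in> S" for s t k using that by (induction k) auto
  have rel_one: "eval_word G (concat (replicate (m s t) [(s, True), (t, True)])) = \<one>"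
    if "s \<in> S" "t \<in> S" for s t
  proof -
    let ?r = "concat (replicate (m s t) [(s, True), (t, True)])"
    have "?r \<in> ?R" unfolding coxeter_relators_def using that by blast
    then have "pres_eq S ?R ?r []"
      using pres_eq.relator[of "[]" S "[]" ?r ?R] by simp
    then have "eval_word G ?r = eval_word G []" using eq[of ?r "[]"] rel_words[OF that] by simp
    then show ?thesis by simp
  qed
  have sq: "s \<otimes> s = \<one>" if "s \<in> S" for s
    using rel_one[OF that that] m[OF that] that SG by (auto simp: eval_word_Cons)
  interpret involution_gens G S
    by unfold_locales (use SG sq in auto)
  \<comment> \<open>A cancelled pair and a relator both evaluate to \<open>\<one>\<close>, so by
    \<open>par_append\<close> the letters after them see the same reflection as without them. It
    remains that they cross each wall an even number of times.\<close>
  have par_eq: "\<forall>r \<in> carrier G. par r u = par r v" if "pres_eq S ?R u v" for u v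
    using that
  proof (induction rule: pres_eq.induct)
    case (cancel u v s b)
    let ?c = "[(s, b), (s, \<not> b)]"
    have c: "?c \<in> words S" using cancel by simp
    have ev: "eval_word G ?c = \<one>" using cancel(3) by (simp add: eval_word_Cons gens_sq)
    show ?case
    proof
      fix r assume r: "r \<in> carrier G"
      let ?r = "inv (eval_word G u) \<otimes> r \<otimes> eval_word G u"
      have r': "?r \<in> carrier G" using r cancel SG by simp
      have "\<not> par ?r ?c" using par_two[OF cancel(3) cancel(3) r', of b "\<not> b"] cancel(3)
        by (simp add: gens_sq)
      then have "par ?r (?c @ v) = par ?r v"
        using par_append[OF c cancel(2) r'] r' unfolding ev by simp
      then show "par r (u @ ?c @ v) = par r (u @ v)"
        using par_append[of u "?c @ v" r] par_append[of u v r] c cancel r by simp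
    qed
  next
    case (relator u v w)
    then obtain s t where st: "s \<in> S" "t \<in> S"
      and w: "w = concat (replicate (m s t) [(s, True), (t, True)])"
      unfolding coxeter_relators_def by blast
    have c: "w \<in> words S" and ev: "eval_word G w = \<one>"
      using rel_words rel_one st w by auto
    have pow: "(s \<otimes> t) [^] m s t = \<one>" using ev eval_alternating st w by simp
    show ?case
    proof
      fix r assume r: "r \<in> carrier G"
      let ?r = "inv (eval_word G u) \<otimes> r \<otimes> eval_word G u"
      have r': "?r \<in> carrier G" using r relator SG by simp
      have "\<not> par ?r w" using par_relator[OF st r' pow] w by simp
      then have "par ?r (w @ v) = par ?r v"
        using par_append[OF c relator(2) r'] r' unfolding ev by simp
      then show "par r (u @ w @ v) = par r (u @ v)"
        using par_append[of u "w @ v" r] par_append[of u v r] c relator r by simp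
    qed
  qed auto
  define rep where "rep w = (SOME u. u \<in> words S \<and> eval_word G u = w)" for w
  have rep: "rep w \<in> words S \<and> eval_word G (rep w) = w" if "w \<in> carrier G" for w
  proof -
    obtain u where "u \<in> words S" "eval_word G u = w"
      using generate_words[OF SG, of w] \<open>w \<in> carrier G\<close> gen by auto
    then show ?thesis unfolding rep_def by (intro someI) auto
  qed
  have par_rep: "par r (rep (eval_word G u)) = par r u" if "u \<in> words S" "r \<in> carrier G" for u r
    using par_eq[of "rep (eval_word G u)" u] eq[of "rep (eval_word G u)" u]
      rep[of "eval_word G u"] that SG by auto
  have "coxeter_halves G S (\<lambda>s w. par s (rep w))"
  proof
    show "finite (carrier G)" using assms by (simp add: finite_coxeter_system_def)
    show "generate G S = carrier G" by (fact gen)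
    show "\<not> par s (rep \<one>)" if "s \<in> S" for s using par_rep[of "[]" s] that by simp
    show "par s (rep (w \<otimes> t)) \<noteq> par s (rep w) \<longleftrightarrow> w \<otimes> t = s \<otimes> w"
      if "s \<in> S" "t \<in> S" "w \<in> carrier G" for s t w
    proof -
      let ?u = "rep w @ [(t, True)]"
      have u: "?u \<in> words S" "eval_word G ?u = w \<otimes> t"
        using rep[OF that(3)] that by (simp_all add: eval_word_append[OF SG] eval_word_Cons)
      have "par s (rep (w \<otimes> t)) = par s ?u" using par_rep[of ?u s] u that by simp
      \<comment> \<open>The last letter crosses the wall of \<open>s\<close> exactly if this wall,
        seen from \<open>w\<close>, is the wall of \<open>t\<close>.\<close>
      also have "\<dots> = (par s (rep w) \<noteq> (t = inv w \<otimes> s \<otimes> w))"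
        using par_append[of "rep w" "[(t, True)]" s] rep[OF that(3)] that by simp
      also have "(t = inv w \<otimes> s \<otimes> w) = (w \<otimes> t = s \<otimes> w)"
        using that by (subst m_assoc) (auto simp: inv_solve_left)
      finally show ?thesis by auto
    qed
  qed
  then show thesis by (rule that)
qed

section \<open>Words and foldings of the Cayley graph\<close>

context coxeter_halves
begin

text \<open>Generators are involutions, so unsigned words suffice; deleting letters is then
  expressed by \<open>subseq\<close>.\<close>

definition ev :: "'a list \<Rightarrow> 'a" where
  "ev z = foldr (\<otimes>) z \<one>"

lemma ev_simps [simp]: "ev [] = \<one>" "ev (s # z) = s \<otimes> ev z"
  by (simp_all add: ev_def)

lemma ev_closed [simp]: "z \<in> lists S \<Longrightarrow> ev z \<in> carrier G"
  by (induction z) auto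

lemma ev_append: "y \<in> lists S \<Longrightarrow> z \<in> lists S \<Longrightarrow> ev (y @ z) = ev y \<otimes> ev z"
proof (induction y)
  case Nil
  then show ?case by (simp)
next
  case (Cons s y)
  then have "s \<in> S" "y \<in> lists S" by auto
  with Cons show ?case by (simp add: m_assoc)
qed

lemma generate_ev:
  assumes "I \<subseteq> S" "g \<in> generate G I"
  obtains z where "z \<in> lists I" "ev z = g"
  using assms(2)
proof (induction g arbitrary: thesis rule: generate.induct)
  case one
  show ?case by (rule one[of "[]"]) simp_all
next
  case (incl s)
  show ?case using assms(1) incl(1) by (intro incl(2)[of "[s]"]) auto
next
  case (inv s)
  then have "s \<in> S" using assms(1) by auto
  then show ?case using inv(1) by (intro inv(2)[of "[s]"]) auto
next
  case (eng g h)
  obtain y where y: "y \<in> lists I" "ev y = g" by (rule eng.IH(1))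
  obtain z where z: "z \<in> lists I" "ev z = h" by (rule eng.IH(2))
  have "y \<in> lists S" "z \<in> lists S" using y z assms(1) by auto
  then show ?case using y z ev_append
    by (intro eng.prems[of "y @ z"]) simp_all
qed

lemma carrier_ev:
  assumes "g \<in> carrier G"
  obtains z where "z \<in> lists S" "ev z = g"
  using generate_ev[of S g] assms gen by blast

lemma lists_subseq: "subseq y z \<Longrightarrow> z \<in> lists I \<Longrightarrow> y \<in> lists I"
  by (auto simp: in_lists_conv_set dest: list_emb_set)

lemma neg_generator: "s \<in> S \<Longrightarrow> t \<in> S \<Longrightarrow> neg s t \<longleftrightarrow> t = s"
  using neg_step[of s t \<one>] neg_one[of s] by simp

text \<open>Multiplying by a letter \<open>t\<close> on the right crosses the wall of
  \<open>s\<close> at \<open>w\<close> iff it does so at \<open>s \<otimes> w\<close>, since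
  \<open>w \<otimes> t = s \<otimes> w\<close> is equivalent to
  \<open>s \<otimes> w \<otimes> t = w\<close>. Thus the opposite sides of \<open>\<one>\<close> and
  \<open>s\<close> stay opposite along every word.\<close>

lemma neg_mult_left:
  assumes "s \<in> S" "w \<in> carrier G"
  shows "neg s (s \<otimes> w) = (\<not> neg s w)"
proof -
  obtain z where "z \<in> lists S" "ev z = w" by (rule carrier_ev[OF assms(2)])
  then show ?thesis
  proof (induction z arbitrary: w rule: rev_induct)
    case Nil
    then show ?case using neg_generator[of s s] neg_one[of s] assms(1) by auto
  next
    case (snoc t z)
    then have z: "z \<in> lists S" "t \<in> S" by auto
    have w: "w = ev z \<otimes> t"
      using snoc.prems z by (simp add: ev_append)
    have IH: "neg s (s \<otimes> ev z) = (\<not> neg s (ev z))" using snoc.IH z by simp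
    have "neg s (s \<otimes> ev z \<otimes> t) \<noteq> neg s (s \<otimes> ev z) \<longleftrightarrow> s \<otimes> ev z \<otimes> t = ev z"
      using neg_step[of s t "s \<otimes> ev z"] assms(1) z by simp
    also have "\<dots> \<longleftrightarrow> ev z \<otimes> t = s \<otimes> ev z"
    proof -
      have "s \<otimes> ev z \<otimes> t = s \<otimes> (ev z \<otimes> t)" using assms(1) z by (simp add: m_assoc)
      moreover have "s \<otimes> (ev z \<otimes> t) = ev z \<longleftrightarrow> s \<otimes> (s \<otimes> (ev z \<otimes> t)) = s \<otimes> ev z"
        using assms(1) z gen_cancel[of s] by (metis ev_closed gen_closed m_closed)
      ultimately show ?thesis using assms(1) z by simp
    qed
    also have "\<dots> \<longleftrightarrow> neg s (ev z \<otimes> t) \<noteq> neg s (ev z)"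
      using neg_step[of s t "ev z"] assms(1) z by simp
    finally show ?case unfolding w using IH assms(1) z by (auto simp: m_assoc)
  qed
qed

text \<open>The deletion property: a gallery that ends behind the wall of \<open>s\<close> crosses
  this wall at some letter, and omitting that letter reflects the end point. Peeling letters off the
  end finds the crossing, where the prefix changes side.\<close>

lemma neg_delete:
  assumes "s \<in> S" "z \<in> lists S" "neg s (ev z)"
  shows "\<exists>z'. subseq z' z \<and> length z' < length z \<and> s \<otimes> ev z = ev z'"
  using assms(2,3)
proof (induction z rule: rev_induct)
  case Nil
  then show ?case using neg_one assms(1) by simp
next
  case (snoc t z)
  then have z: "z \<in> lists S" "t \<in> S" by auto
  have e: "ev (z @ [t]) = ev z \<otimes> t"
    using z by (simp add: ev_append)
  show ?case
  proof (cases "neg s (ev z)")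
    case True
    then obtain z' where z': "subseq z' z" "length z' < length z" "s \<otimes> ev z = ev z'"
      using snoc.IH z by auto
    then have "z' \<in> lists S" using z lists_subseq by blast
    then have "s \<otimes> ev (z @ [t]) = ev (z' @ [t])"
      using z z' assms(1) by (simp add: e ev_append m_assoc[symmetric])
    moreover have "subseq (z' @ [t]) (z @ [t])" using z' by (simp add: list_emb_append_mono)
    ultimately show ?thesis using z' by (intro exI[of _ "z' @ [t]"]) auto
  next
    case False
    then have "ev z \<otimes> t = s \<otimes> ev z"
      using snoc.prems neg_step[of s t "ev z"] assms(1) z by (simp add: e)
    then have "s \<otimes> ev (z @ [t]) = ev z" using assms(1) z by (simp add: e)
    then show ?thesis by (intro exI[of _ z]) auto
  qed
qed

text \<open>If the wall of \<open>t\<close> does not separate \<open>ev (t # y)\<close> from the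
  base chamber, it separates \<open>ev y\<close>, and deletion inside \<open>y\<close> absorbs the
  leading \<open>t\<close>. This shortens words without a length function on the group.\<close>

lemma not_neg_first_letter:
  assumes "t # y \<in> lists S" "\<not> neg t (ev (t # y))"
  obtains y' where "subseq y' y" "length y' < length y" "ev (t # y) = ev y'"
proof -
  have y: "t \<in> S" "y \<in> lists S" using assms(1) by auto
  then have "neg t (ev y)" using assms(2) neg_mult_left[of t "ev y"] by simp
  then show ?thesis using neg_delete[of t y] y that by auto
qed

text \<open>The first letter of a word for \<open>s\<close> over \<open>J\<close> either separates
  \<open>s\<close> from the base chamber, and then equals \<open>s\<close>, or is absorbed by
  deletion, which stays within \<open>J\<close>.\<close>

lemma generator_in_generate:
  assumes "s \<in> S" "J \<subseteq> S" "s \<in> generate G J"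
  shows "s \<in> J"
proof -
  obtain z where "z \<in> lists J" "ev z = s" by (rule generate_ev[OF assms(2,3)])
  then show ?thesis
  proof (induction "length z" arbitrary: z rule: less_induct)
    case less
    have z: "z \<in> lists S" using less.prems assms(2) by auto
    show ?case
    proof (cases z)
      case Nil
      then have "s = \<one>" using less.prems by simp
      then show ?thesis using neg_generator[of s s] neg_one[of s] assms(1) by metis
    next
      case (Cons t y)
      have t: "t \<in> S" "t \<in> J" "y \<in> lists J" using z Cons less.prems by auto
      show ?thesis
      proof (cases "neg t s")
        case True
        then have "s = t" using neg_generator[of t s] assms(1) t by simp
        then show ?thesis using t by simp
      next
        case False
        then obtain y' where "subseq y' y" "length y' < length y" "ev (t # y) = ev y'"
          using not_neg_first_letter[of t y] z Cons less.prems by metis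
        then show ?thesis using less.hyps[of y'] less.prems Cons lists_subseq[of y' y J] t by simp
      qed
    qed
  qed
qed

text \<open>For a reduced word \<open>q\<close> this is the Bruhat interval below
  \<open>ev q\<close>. Prepending a letter adjoins the mirror image, which is what a fold can
  imitate.\<close>

definition Sub :: "'a list \<Rightarrow> 'a set" where
  "Sub q = ev ` {z. subseq z q}"

definition side :: "'a \<Rightarrow> bool \<Rightarrow> 'a set" where
  "side s b = {w \<in> carrier G. neg s w = b}"

definition wfold :: "'a \<Rightarrow> bool \<Rightarrow> 'a set \<Rightarrow> 'a set" where
  "wfold s b F = F \<inter> side s b \<union> (\<otimes>) s ` (F \<inter> side s b)"

lemma Sub_closed: "q \<in> lists S \<Longrightarrow> Sub q \<subseteq> carrier G"
  by (auto simp: Sub_def intro!: ev_closed dest: lists_subseq)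

lemma Sub_Nil: "Sub [] = {\<one>}"
proof -
  have "{z :: 'a list. subseq z []} = {[]}" by auto
  then show ?thesis by (simp add: Sub_def)
qed

lemma Sub_Cons: "Sub (s # q) = Sub q \<union> (\<otimes>) s ` Sub q"
proof -
  have "{z. subseq z (s # q)} = {z. subseq z q} \<union> (#) s ` {z. subseq z q}"
  proof (intro Set.set_eqI iffI)
    fix z assume "z \<in> {z. subseq z (s # q)}"
    then show "z \<in> {z. subseq z q} \<union> (#) s ` {z. subseq z q}"
      by (cases z) (auto simp: subseq_Cons2_iff split: if_splits)
  qed auto
  then show ?thesis by (simp add: Sub_def image_Un image_image)
qed

lemma Sub_neg:
  assumes "s \<in> S" "q \<in> lists S" "w \<in> Sub q" "neg s w"
  shows "s \<otimes> w \<in> Sub q"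
proof -
  obtain z where z: "subseq z q" "w = ev z" using assms(3) by (auto simp: Sub_def)
  then obtain z' where z': "subseq z' z" "s \<otimes> w = ev z'"
    using neg_delete[of s z] assms lists_subseq by blast
  then show ?thesis using z(1) subseq_order.order_trans unfolding Sub_def by blast
qed

text \<open>A subword product on the negative side of \<open>s\<close> is the mirror image of one on the positive
  side, by the deletion property; so folding onto the positive side loses nothing.\<close>

lemma Sub_fold:
  assumes "s \<in> S" "q \<in> lists S"
  shows "Sub (s # q) \<subseteq> wfold s False (Sub q)"
proof -
  have c: "Sub q \<subseteq> carrier G" using Sub_closed assms(2) .
  have *: "w \<in> wfold s False (Sub q) \<and> s \<otimes> w \<in> wfold s False (Sub q)" if w: "w \<in> Sub q" for w
  proof (cases "neg s w")
    case True
    have sw: "s \<otimes> w \<in> Sub q \<inter> side s False"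
      using Sub_neg[OF assms w True] neg_mult_left[of s w] w c True assms(1)
      by (auto simp: side_def)
    moreover have "w = s \<otimes> (s \<otimes> w)" using w c assms(1) by auto
    ultimately show ?thesis unfolding wfold_def by blast
  next
    case False
    then have "w \<in> Sub q \<inter> side s False" using w c by (auto simp: side_def)
    then show ?thesis unfolding wfold_def by blast
  qed
  then show ?thesis unfolding Sub_Cons by blast
qed

lemma wfold_closed: "s \<in> S \<Longrightarrow> wfold s b F \<subseteq> carrier G"
  by (auto simp: wfold_def side_def)

lemma wfold_mono: "F \<subseteq> F' \<Longrightarrow> wfold s b F \<subseteq> wfold s b F'"
  by (auto simp: wfold_def)

text \<open>Concatenating words for all group elements gives such a \<open>q\<close>; it takes the
  place of a word for the longest element.\<close>

lemma Sub_universal: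
  obtains q where "q \<in> lists S" "Sub q = carrier G"
proof -
  have "\<exists>q. q \<in> lists S \<and> A \<subseteq> Sub q" if "finite A" "A \<subseteq> carrier G" for A
    using that
  proof (induction A rule: finite_induct)
    case empty
    then show ?case by (intro exI[of _ "[]"]) auto
  next
    case (insert w A)
    then obtain q where q: "q \<in> lists S" "A \<subseteq> Sub q" by auto
    obtain z where z: "z \<in> lists S" "ev z = w" using carrier_ev[of w] insert.prems by auto
    have "w \<in> Sub (z @ q)" unfolding Sub_def using z(2) by blast
    moreover have "A \<subseteq> Sub (z @ q)" using q(2) unfolding Sub_def
      by (blast intro: list_emb_append2)
    ultimately show ?case using q z by (intro exI[of _ "z @ q"]) auto
  qed
  then obtain q where "q \<in> lists S" "carrier G \<subseteq> Sub q" using fin by blast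
  then show ?thesis using that Sub_closed by blast
qed

text \<open>Folding always towards the side that contains a chosen chamber of \<open>F\<close> adds
  its mirror image, one letter closer to \<open>\<one>\<close>. Once \<open>\<one>\<close> is
  reached, folding towards the base chamber along a universal word, read from its last letter, fills
  the group by \<open>Sub_fold\<close>.\<close>

lemma edge_percolation:
  assumes fold: "\<And>F s b. F \<subseteq> carrier G \<Longrightarrow> s \<in> S \<Longrightarrow> Q F \<Longrightarrow> Q (wfold s b F)"
    and F: "F \<subseteq> carrier G" "F \<noteq> {}" "Q F"
  shows "Q (carrier G)"
proof -
  have one: "\<exists>F. F \<subseteq> carrier G \<and> \<one> \<in> F \<and> Q F"
    if "z \<in> lists S" "ev z \<in> F" "F \<subseteq> carrier G" "Q F" for z F
    using that
  proof (induction z arbitrary: F rule: list.induct)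
    case Nil
    then show ?case by auto
  next
    case (Cons s z)
    let ?b = "neg s (ev (s # z))"
    have s: "s \<in> S" "z \<in> lists S" using Cons.prems(1) by auto
    have "ev (s # z) \<in> F \<inter> side s ?b" using Cons.prems s by (auto simp: side_def)
    moreover have "ev z = s \<otimes> ev (s # z)" using s by simp
    ultimately have "ev z \<in> wfold s ?b F" unfolding wfold_def by blast
    then show ?case
      using Cons.IH[of "wfold s ?b F"] fold[of F s ?b] wfold_closed[of s ?b F] s Cons.prems by blast
  qed
  obtain w where w: "w \<in> F" "w \<in> carrier G" using F by auto
  obtain z where z: "z \<in> lists S" "ev z = w" using carrier_ev w(2) .
  obtain F1 where F1: "F1 \<subseteq> carrier G" "\<one> \<in> F1" "Q F1"
    using one[of z F] w z F by auto
  have chain: "\<exists>F. F \<subseteq> carrier G \<and> Sub q \<subseteq> F \<and> Q F" if "q \<in> lists S" for q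
    using that
  proof (induction q rule: list.induct)
    case Nil
    then show ?case using F1 by (auto simp: Sub_Nil)
  next
    case (Cons s q)
    then have sq: "s \<in> S" "q \<in> lists S" by auto
    then obtain F where F: "F \<subseteq> carrier G" "Sub q \<subseteq> F" "Q F" using Cons.IH by blast
    have "Sub (s # q) \<subseteq> wfold s False F"
      using Sub_fold[OF sq] wfold_mono[OF F(2)] by (rule subset_trans)
    then show ?case
      by (intro exI[of _ "wfold s False F"] conjI wfold_closed[OF sq(1)] fold[OF F(1) sq(1) F(3)])
  qed
  obtain q where "q \<in> lists S" "Sub q = carrier G" by (rule Sub_universal)
  then show ?thesis using chain[of q] by auto
qed

end

section \<open>Foldings of the coset graph\<close>

lemma (in group) l_coset_eq_iff:
  assumes "subgroup H G" "v \<in> carrier G" "w \<in> carrier G"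
  shows "v <# H = w <# H \<longleftrightarrow> inv v \<otimes> w \<in> H"
proof
  assume "v <# H = w <# H"
  then have "w \<in> v <# H" using lcos_self[of w H] assms by simp
  then show "inv v \<otimes> w \<in> H"
    using assms by (auto intro: subgroup.lcos_module_imp group_axioms)
next
  assume h: "inv v \<otimes> w \<in> H"
  have "w = v \<otimes> (inv v \<otimes> w)" using assms by (simp add: m_assoc[symmetric])
  then have "w \<in> v <# H" using h unfolding l_coset_def by blast
  then show "v <# H = w <# H" using assms by (intro l_repr_independence)
qed

context coxeter_halves
begin

definition coset :: "'a set \<Rightarrow> 'a \<Rightarrow> 'a set" where
  "coset I w = w <# generate G I"

abbreviation cosets :: "'a set \<Rightarrow> 'a set set" where
  "cosets I \<equiv> lcosets (generate G I)"

definition meets :: "'a set \<Rightarrow> 'a \<Rightarrow> bool \<Rightarrow> bool" where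
  "meets x s b \<longleftrightarrow> x \<inter> side s b \<noteq> {}"

lemma parabolic_subgroup: "I \<subseteq> S \<Longrightarrow> subgroup (generate G I) G"
  using gens_closed by (intro generate_is_subgroup) auto

lemma parabolic_carrier: "I \<subseteq> S \<Longrightarrow> generate G I \<subseteq> carrier G"
  using gens_closed by (intro generate_incl) auto

lemma cosets_eq: "cosets I = coset I ` carrier G"
  by (auto simp: LCOSETS_def coset_def)

lemma coset_mem: "I \<subseteq> S \<Longrightarrow> w \<in> carrier G \<Longrightarrow> w \<in> coset I w"
  by (simp add: coset_def lcos_self parabolic_subgroup)

lemma coset_carrier: "I \<subseteq> S \<Longrightarrow> w \<in> carrier G \<Longrightarrow> coset I w \<subseteq> carrier G"
  by (simp add: coset_def l_coset_subset_G parabolic_carrier)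

lemma coset_mult: "I \<subseteq> S \<Longrightarrow> g \<in> carrier G \<Longrightarrow> w \<in> carrier G \<Longrightarrow> g <# coset I w = coset I (g \<otimes> w)"
  by (simp add: coset_def lcos_m_assoc parabolic_carrier)

lemma coset_eqI: "I \<subseteq> S \<Longrightarrow> w \<in> carrier G \<Longrightarrow> v \<in> coset I w \<Longrightarrow> coset I v = coset I w"
  unfolding coset_def by (rule l_repr_independence[symmetric]) (simp_all add: parabolic_subgroup)

lemma coset_mult_right:
  "I \<subseteq> S \<Longrightarrow> w \<in> carrier G \<Longrightarrow> h \<in> generate G I \<Longrightarrow> coset I (w \<otimes> h) = coset I w"
  by (rule coset_eqI) (auto simp: coset_def l_coset_def)

lemma coset_eq_iff:
  "I \<subseteq> S \<Longrightarrow> v \<in> carrier G \<Longrightarrow> w \<in> carrier G \<Longrightarrow>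
    coset I v = coset I w \<longleftrightarrow> inv v \<otimes> w \<in> generate G I"
  unfolding coset_def by (rule l_coset_eq_iff[OF parabolic_subgroup])

text \<open>A path inside a coset that changes the side of the wall of \<open>s\<close> crosses this wall, and the
  edge at which it does so is flipped by \<open>s\<close>.\<close>

lemma coset_meets_both:
  assumes I: "I \<subseteq> S" and s: "s \<in> S" and x: "x \<in> cosets I" "meets x s True" "meets x s False"
  shows "s <# x = x"
proof -
  have *: "s <# coset I b = coset I b"
    if "z \<in> lists I" "b \<in> carrier G" "neg s (b \<otimes> ev z) \<noteq> neg s b" for z b
    using that
  proof (induction z arbitrary: b rule: list.induct)
    case Nil
    then show ?case by simp
  next
    case (Cons t z)
    then have t: "t \<in> I" "t \<in> S" "z \<in> lists I" "z \<in> lists S" "b \<in> carrier G" using I by auto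
    have h: "coset I (b \<otimes> t) = coset I b"
      using coset_mult_right[OF I t(5)] t(1) by (simp add: generate.incl)
    show ?case
    proof (cases "neg s (b \<otimes> t) = neg s b")
      case True
      have "b \<otimes> ev (t # z) = b \<otimes> t \<otimes> ev z" using t by (simp add: m_assoc)
      then have "neg s (b \<otimes> t \<otimes> ev z) \<noteq> neg s (b \<otimes> t)" using Cons.prems(3) True by simp
      then show ?thesis using Cons.IH[of "b \<otimes> t"] h t by simp
    next
      case False
      then have "b \<otimes> t = s \<otimes> b" using neg_step[OF s t(2) t(5)] by simp
      then show ?thesis using h coset_mult[OF I, of s b] s t by simp
    qed
  qed
  obtain w where w: "w \<in> carrier G" "x = coset I w" using x(1) by (auto simp: cosets_eq)
  obtain a b where ab: "a \<in> x" "a \<in> carrier G" "neg s a" "b \<in> x" "b \<in> carrier G" "\<not> neg s b"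
    using x(2,3) by (auto simp: meets_def side_def)
  have xb: "x = coset I a" "x = coset I b" using ab w coset_eqI[OF I w(1)] by auto
  then have "inv b \<otimes> a \<in> generate G I" using coset_eq_iff[OF I] ab by auto
  then obtain z where z: "z \<in> lists I" "ev z = inv b \<otimes> a" using generate_ev[OF I] by blast
  have "b \<otimes> ev z = a" using ab z by (simp add: m_assoc[symmetric])
  then show ?thesis using *[OF z(1) ab(5)] ab xb(2) by simp
qed

lemma meets_mult:
  assumes "s \<in> S" "x \<subseteq> carrier G"
  shows "meets (s <# x) s b \<longleftrightarrow> meets x s (\<not> b)"
proof -
  have "s <# x = (\<otimes>) s ` x" by (auto simp: l_coset_def)
  moreover have "s \<otimes> w \<in> side s b \<longleftrightarrow> w \<in> side s (\<not> b)" if "w \<in> x" for w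
    using that assms neg_mult_left[of s w] by (auto simp: side_def)
  ultimately show ?thesis unfolding meets_def by auto
qed

lemma meets_coset: "I \<subseteq> S \<Longrightarrow> w \<in> carrier G \<Longrightarrow> meets (coset I w) s (neg s w)"
  using coset_mem[of I w] by (auto simp: meets_def side_def)

text \<open>Unlike a group element, a coset may meet both sides; it is then fixed by
  \<open>s\<close> (see \<open>coset_meets_both\<close>) and survives in both folds.\<close>

definition cfold :: "'a \<Rightarrow> bool \<Rightarrow> 'a set set \<Rightarrow> 'a set set" where
  "cfold s b U = {x \<in> U. meets x s b} \<union> (<#) s ` {x \<in> U. meets x s b}"

lemma cfold_closed:
  assumes "I \<subseteq> S" "s \<in> S" "U \<subseteq> cosets I"
  shows "cfold s b U \<subseteq> cosets I"
proof -
  have "s <# x \<in> cosets I" if x: "x \<in> cosets I" for x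
    using x assms by (auto simp: cosets_eq coset_mult)
  then show ?thesis using assms(3) by (auto simp: cfold_def)
qed

lemma coset_wfold:
  assumes "I \<subseteq> S" "s \<in> S" "F \<subseteq> carrier G" "coset I ` F \<subseteq> U"
  shows "coset I ` wfold s b F \<subseteq> cfold s b U"
proof -
  have "coset I w \<in> {x \<in> U. meets x s b}" if "w \<in> F \<inter> side s b" for w
    using that assms meets_coset[OF assms(1), of w s] by (auto simp: side_def)
  moreover have "coset I (s \<otimes> w) = s <# coset I w" if "w \<in> F" for w
    using that assms coset_mult[of I s w] by auto
  ultimately show ?thesis unfolding wfold_def cfold_def by auto
qed

text \<open>\<open>Q\<close> travels backwards, from the fold to the set that was folded, because
  Cauchy-Schwarz bounds a set by its two folds. One fold is kept and the other is bounded trivially,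
  which requires it to be nonempty; hence the condition that \<open>U\<close> meets both
  sides.\<close>

lemma vertex_percolation_chain:
  assumes I: "I \<subseteq> S" "S = insert s0 I"
    and top: "Q (cosets I)"
    and fold: "\<And>U s b. U \<subseteq> cosets I \<Longrightarrow> s \<in> S \<Longrightarrow> (\<And>b. \<exists>x \<in> U. meets x s b) \<Longrightarrow>
      Q (cfold s b U) \<Longrightarrow> Q U"
    and U: "U \<subseteq> cosets I" "coset I \<one> \<in> U" "coset I s0 \<in> U"
  shows "Q U"
proof -
  have s0: "s0 \<in> S" using I by simp
  \<comment> \<open>The claim ranges over all \<open>U\<close> that cover the given subword
    products: the fold of a set covering those of \<open>q @ [s0]\<close> covers those of
    \<open>s # q @ [s0]\<close>, so \<open>Q\<close> passes from the longer word to the shorter,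
    down to the seed \<open>[s0]\<close>.\<close>
  have step: "(\<forall>U. U \<subseteq> cosets I \<longrightarrow> coset I ` Sub (q @ [s0]) \<subseteq> U \<longrightarrow> Q U) \<Longrightarrow>
      (\<forall>U. U \<subseteq> cosets I \<longrightarrow> coset I ` Sub [s0] \<subseteq> U \<longrightarrow> Q U)" if "q \<in> lists S" for q
    using that
  proof (induction q rule: list.induct)
    case Nil
    then show ?case by simp
  next
    case (Cons s q)
    then have s: "s \<in> S" and q: "q @ [s0] \<in> lists S" using s0 by auto
    have "Q U" if U: "U \<subseteq> cosets I" "coset I ` Sub (q @ [s0]) \<subseteq> U" for U
    proof (rule fold[OF U(1) s])
      have "subseq [s0] (q @ [s0])" by (rule list_emb_append2) simp
      then have sub: "{\<one>, s0} \<subseteq> Sub (q @ [s0])"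
        using s0 by (auto simp: Sub_def image_iff intro: exI[of _ "[]"] exI[of _ "[s0]"])
      \<comment> \<open>The coset of \<open>\<one>\<close> meets the positive side. For
        \<open>s \<in> I\<close> it contains \<open>s\<close> and so meets the negative side as
        well; for \<open>s = s0\<close> the coset of \<open>s0\<close> does.\<close>
      show "\<exists>x \<in> U. meets x s b" for b
      proof (cases b)
        case False
        then show ?thesis using meets_coset[OF I(1), of \<one> s] neg_one[OF s] sub U(2)
          by (intro bexI[of _ "coset I \<one>"]) auto
      next
        case True
        show ?thesis
        proof (cases "s = s0")
          case True
          then show ?thesis using \<open>b\<close> meets_coset[OF I(1), of s0 s0] neg_generator[of s0 s0] s0 sub U(2)
            by (intro bexI[of _ "coset I s0"]) auto
        next
          case False
          then have "s \<in> generate G I" using s I(2) by (auto intro: generate.incl)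
          then have "coset I s = coset I \<one>" using coset_mult_right[OF I(1), of \<one> s] s by simp
          then show ?thesis using True meets_coset[OF I(1), of s s] neg_generator[of s s] s sub U(2)
            by (intro bexI[of _ "coset I \<one>"]) auto
        qed
      qed
      have "coset I ` Sub (s # q @ [s0]) \<subseteq> coset I ` wfold s False (Sub (q @ [s0]))"
        using Sub_fold[OF s q] by auto
      also have "\<dots> \<subseteq> cfold s False U"
        using coset_wfold[OF I(1) s _ U(2)] Sub_closed[OF q] by blast
      finally show "Q (cfold s False U)"
        using Cons.prems(1) cfold_closed[OF I(1) s U(1), of False] by simp
    qed
    then show ?case using Cons s0 by simp
  qed
  obtain q where q: "q \<in> lists S" "Sub q = carrier G" by (rule Sub_universal)
  have "Sub q \<subseteq> Sub (q @ [s0])" unfolding Sub_def by (auto intro: list_emb_prefix)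
  then have "coset I ` Sub (q @ [s0]) = cosets I"
    using q Sub_closed[of "q @ [s0]"] s0 by (auto simp: cosets_eq)
  then have "\<forall>U. U \<subseteq> cosets I \<longrightarrow> coset I ` Sub (q @ [s0]) \<subseteq> U \<longrightarrow> Q U"
    using top by auto
  moreover have "coset I ` Sub [s0] \<subseteq> U" using U s0 by (auto simp: Sub_Cons Sub_Nil)
  ultimately show ?thesis using step[OF q(1)] U(1) by blast
qed

text \<open>A translation moves one vertex to the coset of \<open>\<one>\<close>; the word of the
  other is then shortened. A first letter that does not separate is absorbed. A separating first
  letter in \<open>I\<close> fixes the coset of \<open>\<one>\<close>, so folding to the negative
  side keeps that coset and reflects the other vertex to a shorter word, still distinct. A
  separating first letter \<open>s0\<close> yields the seed of
  \<open>vertex_percolation_chain\<close>.\<close>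

lemma vertex_percolation:
  assumes I: "I \<subseteq> S" "S = insert s0 I"
    and top: "Q (cosets I)"
    and fold: "\<And>U s b. U \<subseteq> cosets I \<Longrightarrow> s \<in> S \<Longrightarrow> (\<And>b. \<exists>x \<in> U. meets x s b) \<Longrightarrow>
      Q (cfold s b U) \<Longrightarrow> Q U"
    and shift: "\<And>U g. U \<subseteq> cosets I \<Longrightarrow> g \<in> carrier G \<Longrightarrow> Q ((<#) g ` U) \<Longrightarrow> Q U"
    and U: "U \<subseteq> cosets I" "x \<in> U" "y \<in> U" "x \<noteq> y"
  shows "Q U"
proof -
  have s0: "s0 \<in> S" using I by simp
  have *: "Q U" if "U \<subseteq> cosets I" "coset I \<one> \<in> U" "z \<in> lists S" "coset I (ev z) \<in> U"
    "coset I (ev z) \<noteq> coset I \<one>" for U z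
    using that
  proof (induction "length z" arbitrary: z U rule: less_induct)
    case less
    note U = less.prems(1,2,4)
    obtain t y where z: "z = t # y" using less.prems(5) by (cases z) auto
    have t: "t \<in> S" "y \<in> lists S" using less.prems(3) z by auto
    show ?case
    proof (cases "neg t (ev z)")
      case False
      then obtain y' where y': "subseq y' y" "length y' < length y" "ev (t # y) = ev y'"
        using not_neg_first_letter[of t y] z less.prems by metis
      then have "y' \<in> lists S" using lists_subseq t by blast
      then show ?thesis using less.hyps[of y' U] less.prems y' z by simp
    next
      case True
      have mz: "meets (coset I (ev z)) t True"
        using meets_coset[OF I(1), of "ev z" t] True less.prems(3) by simp
      have mone: "meets (coset I \<one>) t False"
        using meets_coset[OF I(1), of \<one> t] neg_one[OF t(1)] by simp
      have both: "\<exists>x \<in> U. meets x t b" for b using mz mone U by (cases b) auto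
      show ?thesis
      proof (cases "t = s0")
        case True
        have m: "coset I \<one> \<in> {x \<in> U. meets x t False}" using mone U by simp
        then have m1: "coset I \<one> \<in> cfold t False U" unfolding cfold_def by blast
        have "coset I s0 = t <# coset I \<one>"
          using coset_mult[OF I(1), of t \<one>] t True by simp
        then have m2: "coset I s0 \<in> cfold t False U" using m unfolding cfold_def by blast
        have "Q (cfold t False U)"
        proof (rule vertex_percolation_chain[where Q = Q, OF I top])
          show "Q V" if "V \<subseteq> cosets I" "s \<in> S" "\<And>b. \<exists>x \<in> V. meets x s b" "Q (cfold s b V)"
            for V s b using that by (rule fold)
        qed (fact m1 m2 cfold_closed[OF I(1) t(1) U(1), of False])+
        then show ?thesis by (rule fold[OF U(1) t(1) both])
      next
        case False
        then have "t \<in> generate G I" using t I(2) by (auto intro: generate.incl)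
        then have tI: "coset I t = coset I \<one>" using coset_mult_right[OF I(1), of \<one> t] t by simp
        then have "meets (coset I \<one>) t True"
          using meets_coset[OF I(1), of t t] neg_generator[of t t] t by simp
        then have a: "coset I \<one> \<in> cfold t True U" using U by (simp add: cfold_def)
        have e: "t <# coset I (ev z) = coset I (ev y)"
          using coset_mult[OF I(1), of t "ev z"] t z by simp
        have "coset I (ev z) \<in> {x \<in> U. meets x t True}" using mz U by simp
        then have "t <# coset I (ev z) \<in> cfold t True U" unfolding cfold_def by blast
        then have b: "coset I (ev y) \<in> cfold t True U" by (simp only: e)
        have c: "coset I (ev y) \<noteq> coset I \<one>"
        proof
          assume "coset I (ev y) = coset I \<one>"
          then have "t <# coset I (ev y) = coset I \<one>"
            using coset_mult[OF I(1), of t \<one>] t tI by simp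
          then show False using coset_mult[OF I(1), of t "ev y"] t z less.prems(5) by simp
        qed
        have "Q (cfold t True U)"
          using less.hyps[OF _ cfold_closed[OF I(1) t(1) U(1)] a t(2) b c] z by simp
        then show ?thesis by (rule fold[OF U(1) t(1) both])
      qed
    qed
  qed
  obtain g h where g: "g \<in> carrier G" "x = coset I g" and h: "h \<in> carrier G" "y = coset I h"
    using U unfolding cosets_eq by blast
  obtain z where z: "z \<in> lists S" "ev z = inv g \<otimes> h" using carrier_ev[of "inv g \<otimes> h"] g h by auto
  let ?U = "(<#) (inv g) ` U"
  have "?U \<subseteq> cosets I"
    using U(1) g by (force simp: cosets_eq coset_mult[OF I(1)])
  moreover have "coset I \<one> \<in> ?U"
    using U(2) g coset_mult[OF I(1), of "inv g" g] by (intro image_eqI[of _ _ x]) auto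
  moreover have "coset I (ev z) \<in> ?U"
    using U(3) g h z coset_mult[OF I(1), of "inv g" h] by (intro image_eqI[of _ _ y]) auto
  moreover have "coset I (ev z) \<noteq> coset I \<one>"
  proof
    assume "coset I (ev z) = coset I \<one>"
    then have "g <# coset I (ev z) = g <# coset I \<one>" by simp
    then show False using U(4) g h z coset_mult[OF I(1), of g] by (simp add: m_assoc[symmetric])
  qed
  ultimately have "Q ?U" using * z(1) by blast
  then show ?thesis using shift[OF U(1), of "inv g"] g by simp
qed

end

section \<open>Cauchy-Schwarz for foldings\<close>

text \<open>A map on \<open>V\<close> is a pair of maps on \<open>L\<close> and \<open>R\<close>
  with a common restriction \<open>h\<close> to the overlap. Each condition sees only one of the
  two, so for fixed \<open>h\<close> the counts multiply.\<close>

lemma card_PiE_glue: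
  fixes P Q :: "('v \<Rightarrow> 'z) \<Rightarrow> bool"
  assumes V: "finite V" "V = L \<union> R" and Z: "finite Z"
    and P: "\<And>f g. (\<And>v. v \<in> L \<Longrightarrow> f v = g v) \<Longrightarrow> P f = P g"
    and Q: "\<And>f g. (\<And>v. v \<in> R \<Longrightarrow> f v = g v) \<Longrightarrow> Q f = Q g"
  shows "card {f \<in> V \<rightarrow>\<^sub>E Z. P f \<and> Q f} =
    (\<Sum>h \<in> (L \<inter> R) \<rightarrow>\<^sub>E Z. card {f \<in> L \<rightarrow>\<^sub>E Z. P f \<and> restrict f (L \<inter> R) = h} *
      card {g \<in> R \<rightarrow>\<^sub>E Z. Q g \<and> restrict g (L \<inter> R) = h})"
proof -
  let ?A = "\<lambda>h. {f \<in> L \<rightarrow>\<^sub>E Z. P f \<and> restrict f (L \<inter> R) = h}"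
  let ?B = "\<lambda>h. {g \<in> R \<rightarrow>\<^sub>E Z. Q g \<and> restrict g (L \<inter> R) = h}"
  have fin: "finite L" "finite R" using V by auto
  have "bij_betw (\<lambda>f. (restrict f (L \<inter> R), restrict f L, restrict f R))
      {f \<in> V \<rightarrow>\<^sub>E Z. P f \<and> Q f} (SIGMA h : (L \<inter> R) \<rightarrow>\<^sub>E Z. ?A h \<times> ?B h)"
  proof (rule bij_betw_byWitness[where f' = "\<lambda>(h, f, g). \<lambda>v \<in> V. if v \<in> L then f v else g v"])
    show "\<forall>f \<in> {f \<in> V \<rightarrow>\<^sub>E Z. P f \<and> Q f}. (\<lambda>(h, f, g). \<lambda>v \<in> V. if v \<in> L then f v else g v)
        (restrict f (L \<inter> R), restrict f L, restrict f R) = f"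
      using V(2) by (auto simp: fun_eq_iff restrict_def PiE_def extensional_def)
    show "\<forall>p \<in> SIGMA h : (L \<inter> R) \<rightarrow>\<^sub>E Z. ?A h \<times> ?B h. (\<lambda>f. (restrict f (L \<inter> R), restrict f L, restrict f R))
        ((\<lambda>(h, f, g). \<lambda>v \<in> V. if v \<in> L then f v else g v) p) = p"
    proof
      fix p assume "p \<in> (SIGMA h : (L \<inter> R) \<rightarrow>\<^sub>E Z. ?A h \<times> ?B h)"
      then obtain h f g where p: "p = (h, f, g)" "f \<in> L \<rightarrow>\<^sub>E Z" "g \<in> R \<rightarrow>\<^sub>E Z"
        and h: "restrict f (L \<inter> R) = h" "restrict g (L \<inter> R) = h" by auto
      have fg: "f v = g v" if "v \<in> L" "v \<in> R" for v
        using h that by (metis IntI restrict_apply')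
      let ?k = "\<lambda>v \<in> V. if v \<in> L then f v else g v"
      have "restrict ?k (L \<inter> R) = h" unfolding h(1)[symmetric] using V(2) by (auto simp: restrict_def)
      moreover have "restrict ?k L = f" using p(2) V(2) by (auto simp: fun_eq_iff restrict_def PiE_def extensional_def)
      moreover have "restrict ?k R = g" using p(3) V(2) fg by (auto simp: fun_eq_iff restrict_def PiE_def extensional_def)
      ultimately show "(\<lambda>f. (restrict f (L \<inter> R), restrict f L, restrict f R))
        ((\<lambda>(h, f, g). \<lambda>v \<in> V. if v \<in> L then f v else g v) p) = p" using p(1) by simp
    qed
    show "(\<lambda>f. (restrict f (L \<inter> R), restrict f L, restrict f R)) ` {f \<in> V \<rightarrow>\<^sub>E Z. P f \<and> Q f}
        \<subseteq> (SIGMA h : (L \<inter> R) \<rightarrow>\<^sub>E Z. ?A h \<times> ?B h)"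
    proof (rule image_subsetI)
      fix f assume "f \<in> {f \<in> V \<rightarrow>\<^sub>E Z. P f \<and> Q f}"
      then have f: "f \<in> V \<rightarrow>\<^sub>E Z" "P f" "Q f" by auto
      have "P (restrict f L)" using f(2) P[of "restrict f L" f] by simp
      moreover have "Q (restrict f R)" using f(3) Q[of "restrict f R" f] by simp
      moreover have "L \<inter> (L \<inter> R) = L \<inter> R" "R \<inter> (L \<inter> R) = L \<inter> R" by auto
      ultimately show "(restrict f (L \<inter> R), restrict f L, restrict f R) \<in> (SIGMA h : (L \<inter> R) \<rightarrow>\<^sub>E Z. ?A h \<times> ?B h)"
        using f(1) V(2) by (auto simp: restrict_restrict)
    qed
    show "(\<lambda>(h, f, g). \<lambda>v \<in> V. if v \<in> L then f v else g v) ` (SIGMA h : (L \<inter> R) \<rightarrow>\<^sub>E Z. ?A h \<times> ?B h)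
        \<subseteq> {f \<in> V \<rightarrow>\<^sub>E Z. P f \<and> Q f}"
    proof (rule image_subsetI)
      fix p assume "p \<in> (SIGMA h : (L \<inter> R) \<rightarrow>\<^sub>E Z. ?A h \<times> ?B h)"
      then obtain h f g where p: "p = (h, f, g)" and fg: "f \<in> L \<rightarrow>\<^sub>E Z" "g \<in> R \<rightarrow>\<^sub>E Z" "P f" "Q g"
        "restrict g (L \<inter> R) = restrict f (L \<inter> R)" by auto
      let ?k = "\<lambda>v \<in> V. if v \<in> L then f v else g v"
      have eq: "f v = g v" if "v \<in> L" "v \<in> R" for v
        using fg(5) that by (metis IntI restrict_apply')
      have "P ?k" using fg(3) P[of ?k f] V(2) by simp
      moreover have "Q ?k" using fg(4) Q[of ?k g] V(2) eq by simp
      moreover have "?k \<in> V \<rightarrow>\<^sub>E Z" using fg(1,2) V(2) by auto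
      ultimately show "(\<lambda>(h, f, g). \<lambda>v \<in> V. if v \<in> L then f v else g v) p \<in> {f \<in> V \<rightarrow>\<^sub>E Z. P f \<and> Q f}"
        using p by simp
    qed
  qed
  then have "card {f \<in> V \<rightarrow>\<^sub>E Z. P f \<and> Q f} = card (SIGMA h : (L \<inter> R) \<rightarrow>\<^sub>E Z. ?A h \<times> ?B h)"
    by (rule bij_betw_same_card)
  also have "\<dots> = (\<Sum>h \<in> (L \<inter> R) \<rightarrow>\<^sub>E Z. card (?A h \<times> ?B h))"
    using fin Z by (intro card_SigmaI) (auto simp: finite_PiE)
  finally show ?thesis by (simp add: card_cartesian_product)
qed

text \<open>Composition with \<open>\<sigma>\<close> exchanges maps on \<open>R\<close> and maps on
  \<open>L\<close>; it preserves the restriction \<open>h\<close> because \<open>\<sigma>\<close>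
  fixes the overlap pointwise.\<close>

lemma card_PiE_reflect:
  fixes P :: "('v \<Rightarrow> 'z) \<Rightarrow> bool"
  assumes \<sigma>: "\<sigma> ` L \<subseteq> R" "\<sigma> ` R \<subseteq> L" "\<And>v. v \<in> L \<union> R \<Longrightarrow> \<sigma> (\<sigma> v) = v"
      "\<And>v. v \<in> L \<inter> R \<Longrightarrow> \<sigma> v = v"
    and P: "\<And>f g. (\<And>v. v \<in> L \<Longrightarrow> f v = g v) \<Longrightarrow> P f = P g"
  shows "card {g \<in> R \<rightarrow>\<^sub>E Z. P (\<lambda>v. g (\<sigma> v)) \<and> restrict g (L \<inter> R) = h} =
    card {f \<in> L \<rightarrow>\<^sub>E Z. P f \<and> restrict f (L \<inter> R) = h}"
proof (rule bij_betw_same_card)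
  show "bij_betw (\<lambda>g. \<lambda>v \<in> L. g (\<sigma> v))
    {g \<in> R \<rightarrow>\<^sub>E Z. P (\<lambda>v. g (\<sigma> v)) \<and> restrict g (L \<inter> R) = h}
    {f \<in> L \<rightarrow>\<^sub>E Z. P f \<and> restrict f (L \<inter> R) = h}"
  proof (rule bij_betw_byWitness[where f' = "\<lambda>f. \<lambda>v \<in> R. f (\<sigma> v)"])
    show "\<forall>g \<in> {g \<in> R \<rightarrow>\<^sub>E Z. P (\<lambda>v. g (\<sigma> v)) \<and> restrict g (L \<inter> R) = h}.
        (\<lambda>v \<in> R. (\<lambda>v \<in> L. g (\<sigma> v)) (\<sigma> v)) = g"
      using \<sigma>(2,3) by (auto simp: fun_eq_iff restrict_def PiE_def extensional_def)
    show "\<forall>f \<in> {f \<in> L \<rightarrow>\<^sub>E Z. P f \<and> restrict f (L \<inter> R) = h}.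
        (\<lambda>v \<in> L. (\<lambda>v \<in> R. f (\<sigma> v)) (\<sigma> v)) = f"
      using \<sigma>(1,3) by (auto simp: fun_eq_iff restrict_def PiE_def extensional_def)
    show "(\<lambda>g. \<lambda>v \<in> L. g (\<sigma> v)) ` {g \<in> R \<rightarrow>\<^sub>E Z. P (\<lambda>v. g (\<sigma> v)) \<and> restrict g (L \<inter> R) = h}
        \<subseteq> {f \<in> L \<rightarrow>\<^sub>E Z. P f \<and> restrict f (L \<inter> R) = h}"
    proof clarify
      fix g assume g: "g \<in> R \<rightarrow>\<^sub>E Z" "P (\<lambda>v. g (\<sigma> v))" "h = restrict g (L \<inter> R)"
      have "P (\<lambda>v \<in> L. g (\<sigma> v))" using g(2) P[of "\<lambda>v \<in> L. g (\<sigma> v)" "\<lambda>v. g (\<sigma> v)"] by simp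
      moreover have "(\<lambda>v \<in> L. g (\<sigma> v)) \<in> L \<rightarrow>\<^sub>E Z" using g(1) \<sigma>(1) by auto
      moreover have "restrict (\<lambda>v \<in> L. g (\<sigma> v)) (L \<inter> R) = restrict g (L \<inter> R)"
        using \<sigma>(4) by (auto simp: restrict_def)
      ultimately show "(\<lambda>v \<in> L. g (\<sigma> v)) \<in> L \<rightarrow>\<^sub>E Z \<and> P (\<lambda>v \<in> L. g (\<sigma> v)) \<and>
          restrict (\<lambda>v \<in> L. g (\<sigma> v)) (L \<inter> R) = restrict g (L \<inter> R)" by simp
    qed
    show "(\<lambda>f. \<lambda>v \<in> R. f (\<sigma> v)) ` {f \<in> L \<rightarrow>\<^sub>E Z. P f \<and> restrict f (L \<inter> R) = h}
        \<subseteq> {g \<in> R \<rightarrow>\<^sub>E Z. P (\<lambda>v. g (\<sigma> v)) \<and> restrict g (L \<inter> R) = h}"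
    proof clarify
      fix f assume f: "f \<in> L \<rightarrow>\<^sub>E Z" "P f" "h = restrict f (L \<inter> R)"
      have "P (\<lambda>v. (\<lambda>v \<in> R. f (\<sigma> v)) (\<sigma> v))"
        using f(2) P[of "\<lambda>v. (\<lambda>v \<in> R. f (\<sigma> v)) (\<sigma> v)" f] \<sigma>(1,3) by (auto simp: image_subset_iff)
      moreover have "(\<lambda>v \<in> R. f (\<sigma> v)) \<in> R \<rightarrow>\<^sub>E Z" using f(1) \<sigma>(2) by auto
      moreover have "restrict (\<lambda>v \<in> R. f (\<sigma> v)) (L \<inter> R) = restrict f (L \<inter> R)"
        using \<sigma>(4) by (auto simp: restrict_def)
      ultimately show "(\<lambda>v \<in> R. f (\<sigma> v)) \<in> R \<rightarrow>\<^sub>E Z \<and> P (\<lambda>v. (\<lambda>v \<in> R. f (\<sigma> v)) (\<sigma> v)) \<and>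
          restrict (\<lambda>v \<in> R. f (\<sigma> v)) (L \<inter> R) = restrict f (L \<inter> R)" by simp
    qed
  qed
qed

lemma Cauchy_Schwarz_nat:
  fixes a b :: "'i \<Rightarrow> nat"
  shows "(\<Sum>i\<in>A. a i * b i)\<^sup>2 \<le> (\<Sum>i\<in>A. (a i)\<^sup>2) * (\<Sum>i\<in>A. (b i)\<^sup>2)"
proof -
  have "(\<Sum>i\<in>A. real (a i) * real (b i))\<^sup>2 \<le> (\<Sum>i\<in>A. (real (a i))\<^sup>2) * (\<Sum>i\<in>A. (real (b i))\<^sup>2)"
    by (rule Cauchy_Schwarz_ineq_sum)
  then have "real ((\<Sum>i\<in>A. a i * b i)\<^sup>2) \<le> real ((\<Sum>i\<in>A. (a i)\<^sup>2) * (\<Sum>i\<in>A. (b i)\<^sup>2))"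
    by simp
  then show ?thesis by (simp only: of_nat_le_iff)
qed

text \<open>With \<open>h\<close> the restriction to the overlap, the number to be squared is a sum
  of products \<open>a h * b h\<close>. Gluing a half to its own mirror image gives the sums of the
  squares, so this is Cauchy-Schwarz over \<open>h\<close>.\<close>

lemma fold_Cauchy_Schwarz:
  fixes P Q :: "('v \<Rightarrow> 'z) \<Rightarrow> bool"
  assumes V: "finite V" "V = L \<union> R" and Z: "finite Z"
    and \<sigma>: "\<sigma> ` L \<subseteq> R" "\<sigma> ` R \<subseteq> L" "\<And>v. v \<in> V \<Longrightarrow> \<sigma> (\<sigma> v) = v"
      "\<And>v. v \<in> L \<Longrightarrow> v \<in> R \<Longrightarrow> \<sigma> v = v"
    and P: "\<And>f g. (\<And>v. v \<in> L \<Longrightarrow> f v = g v) \<Longrightarrow> P f = P g"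
    and Q: "\<And>f g. (\<And>v. v \<in> R \<Longrightarrow> f v = g v) \<Longrightarrow> Q f = Q g"
  shows "(card {f \<in> V \<rightarrow>\<^sub>E Z. P f \<and> Q f})\<^sup>2 \<le>
    card {f \<in> V \<rightarrow>\<^sub>E Z. P f \<and> P (\<lambda>v. f (\<sigma> v))} * card {f \<in> V \<rightarrow>\<^sub>E Z. Q f \<and> Q (\<lambda>v. f (\<sigma> v))}"
proof -
  let ?a = "\<lambda>h. card {f \<in> L \<rightarrow>\<^sub>E Z. P f \<and> restrict f (L \<inter> R) = h}"
  let ?b = "\<lambda>h. card {f \<in> R \<rightarrow>\<^sub>E Z. Q f \<and> restrict f (L \<inter> R) = h}"
  let ?K = "(L \<inter> R) \<rightarrow>\<^sub>E Z"
  have P': "P (\<lambda>v. f (\<sigma> v)) = P (\<lambda>v. g (\<sigma> v))" if "\<And>v. v \<in> R \<Longrightarrow> f v = g v" for f g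
    by (rule P) (use \<sigma>(1) that in auto)
  have Q': "Q (\<lambda>v. f (\<sigma> v)) = Q (\<lambda>v. g (\<sigma> v))" if "\<And>v. v \<in> L \<Longrightarrow> f v = g v" for f g
    by (rule Q) (use \<sigma>(2) that in auto)
  have VRL: "V = R \<union> L" and RL: "R \<inter> L = L \<inter> R" using V(2) by auto
  have "card {f \<in> V \<rightarrow>\<^sub>E Z. P f \<and> Q f} = (\<Sum>h \<in> ?K. ?a h * ?b h)"
    by (rule card_PiE_glue[OF V Z P Q])
  moreover have "card {f \<in> V \<rightarrow>\<^sub>E Z. P f \<and> P (\<lambda>v. f (\<sigma> v))} = (\<Sum>h \<in> ?K. (?a h)\<^sup>2)"
  proof -
    have "card {f \<in> V \<rightarrow>\<^sub>E Z. P f \<and> P (\<lambda>v. f (\<sigma> v))} = (\<Sum>h \<in> ?K. ?a h *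
       card {g \<in> R \<rightarrow>\<^sub>E Z. P (\<lambda>v. g (\<sigma> v)) \<and> restrict g (L \<inter> R) = h})"
      by (rule card_PiE_glue[OF V Z P P'])
    also have "\<dots> = (\<Sum>h \<in> ?K. ?a h * ?a h)"
      by (subst card_PiE_reflect[OF \<sigma>(1,2) _ _ P]) (use \<sigma> V(2) in auto)
    finally show ?thesis by (simp add: power2_eq_square)
  qed
  moreover have "card {f \<in> V \<rightarrow>\<^sub>E Z. Q f \<and> Q (\<lambda>v. f (\<sigma> v))} = (\<Sum>h \<in> ?K. (?b h)\<^sup>2)"
  proof -
    have r: "card {g \<in> L \<rightarrow>\<^sub>E Z. Q (\<lambda>v. g (\<sigma> v)) \<and> restrict g (R \<inter> L) = h} =
        card {f \<in> R \<rightarrow>\<^sub>E Z. Q f \<and> restrict f (R \<inter> L) = h}" for h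
      by (rule card_PiE_reflect[where P = Q, OF \<sigma>(2,1) _ _ Q]) (use \<sigma> V(2) in auto)
    have "card {f \<in> V \<rightarrow>\<^sub>E Z. Q f \<and> Q (\<lambda>v. f (\<sigma> v))} = (\<Sum>h \<in> ?K. ?b h *
       card {g \<in> L \<rightarrow>\<^sub>E Z. Q (\<lambda>v. g (\<sigma> v)) \<and> restrict g (L \<inter> R) = h})"
      using card_PiE_glue[OF V(1) VRL Z Q Q'] unfolding RL .
    also have "\<dots> = (\<Sum>h \<in> ?K. ?b h * ?b h)"
      using r unfolding RL by simp
    finally show ?thesis by (simp add: power2_eq_square)
  qed
  ultimately show ?thesis using Cauchy_Schwarz_nat[of ?a ?b ?K] by simp
qed

lemma card_PiE_reindex:
  fixes P :: "('v \<Rightarrow> 'z) \<Rightarrow> bool"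
  assumes \<pi>: "bij_betw \<pi> V V"
    and P: "\<And>f g. (\<And>v. v \<in> V \<Longrightarrow> f v = g v) \<Longrightarrow> P f = P g"
  shows "card {f \<in> V \<rightarrow>\<^sub>E Z. P (\<lambda>v. f (\<pi> v))} = card {f \<in> V \<rightarrow>\<^sub>E Z. P f}"
proof (rule bij_betw_same_card)
  let ?\<rho> = "inv_into V \<pi>"
  have \<rho>: "?\<rho> v \<in> V" "\<pi> (?\<rho> v) = v" "?\<rho> (\<pi> v) = v" "\<pi> v \<in> V" if "v \<in> V" for v
    using that \<pi> bij_betwE[OF \<pi>] bij_betwE[OF bij_betw_inv_into[OF \<pi>]]
    by (auto simp: bij_betw_inv_into_right bij_betw_inv_into_left)
  show "bij_betw (\<lambda>f. \<lambda>v \<in> V. f (\<pi> v)) {f \<in> V \<rightarrow>\<^sub>E Z. P (\<lambda>v. f (\<pi> v))} {f \<in> V \<rightarrow>\<^sub>E Z. P f}"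
  proof (rule bij_betw_byWitness[where f' = "\<lambda>f. \<lambda>v \<in> V. f (?\<rho> v)"])
    show "(\<lambda>f. \<lambda>v \<in> V. f (\<pi> v)) ` {f \<in> V \<rightarrow>\<^sub>E Z. P (\<lambda>v. f (\<pi> v))} \<subseteq> {f \<in> V \<rightarrow>\<^sub>E Z. P f}"
    proof clarify
      fix f assume f: "f \<in> V \<rightarrow>\<^sub>E Z" "P (\<lambda>v. f (\<pi> v))"
      then show "(\<lambda>v \<in> V. f (\<pi> v)) \<in> V \<rightarrow>\<^sub>E Z \<and> P (\<lambda>v \<in> V. f (\<pi> v))"
        using P[of "\<lambda>v \<in> V. f (\<pi> v)" "\<lambda>v. f (\<pi> v)"] \<rho> by auto
    qed
    show "(\<lambda>f. \<lambda>v \<in> V. f (?\<rho> v)) ` {f \<in> V \<rightarrow>\<^sub>E Z. P f} \<subseteq> {f \<in> V \<rightarrow>\<^sub>E Z. P (\<lambda>v. f (\<pi> v))}"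
    proof clarify
      fix f assume f: "f \<in> V \<rightarrow>\<^sub>E Z" "P f"
      then show "(\<lambda>v \<in> V. f (?\<rho> v)) \<in> V \<rightarrow>\<^sub>E Z \<and> P (\<lambda>v. (\<lambda>v \<in> V. f (?\<rho> v)) (\<pi> v))"
        using P[of "\<lambda>v. (\<lambda>v \<in> V. f (?\<rho> v)) (\<pi> v)" f] \<rho> by auto
    qed
  qed (use \<rho> in \<open>auto simp: fun_eq_iff restrict_def PiE_def extensional_def\<close>)
qed

section \<open>Counting homomorphisms of the coset graph\<close>

locale parabolic_pair = coxeter_halves G S neg for G (structure) and S neg +
  fixes I J :: "'a set"
  assumes I: "I \<subseteq> S" and J: "J \<subseteq> S"
begin

definition V :: "('a set + 'a set) set" where
  "V = cosets I <+> cosets J"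

definition act :: "'a \<Rightarrow> 'a set + 'a set \<Rightarrow> 'a set + 'a set" where
  "act g = map_sum ((<#) g) ((<#) g)"

text \<open>Closed half-spaces: they overlap exactly in the vertices whose coset meets both sides,
  that is, the wall.\<close>

definition half :: "'a \<Rightarrow> bool \<Rightarrow> ('a set + 'a set) set" where
  "half s b = {v \<in> V. meets (case_sum id id v) s b}"

definition vfold :: "'a \<Rightarrow> bool \<Rightarrow> ('a set + 'a set) set \<Rightarrow> ('a set + 'a set) set" where
  "vfold s b U = U \<inter> half s b \<union> act s ` (U \<inter> half s b)"

text \<open>Edges are indexed by group elements, so an edge has as many labels as
  \<open>W\<^sub>I \<inter> W\<^sub>J\<close> has elements. \<open>E\<close> is directed, from
  images of the part of \<open>I\<close> to images of the part of \<open>J\<close>.\<close>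

definition edges_ok :: "('z \<times> 'z) set \<Rightarrow> 'a set \<Rightarrow> ('a set + 'a set \<Rightarrow> 'z) \<Rightarrow> bool" where
  "edges_ok E F f \<longleftrightarrow> (\<forall>w \<in> F. (f (Inl (coset I w)), f (Inr (coset J w))) \<in> E)"

definition cnt :: "'z set \<Rightarrow> ('z \<times> 'z) set \<Rightarrow> 'a set \<Rightarrow> ('a set + 'a set) set \<Rightarrow> 'z \<Rightarrow> nat" where
  "cnt Z E F U u = card {f \<in> V \<rightarrow>\<^sub>E Z. edges_ok E F f \<and> (\<forall>x \<in> U. f x = u)}"

definition homs :: "'z set \<Rightarrow> ('z \<times> 'z) set \<Rightarrow> nat" where
  "homs Z E = card {f \<in> V \<rightarrow>\<^sub>E Z. edges_ok E (carrier G) f}"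

definition mono_homs :: "'z set \<Rightarrow> ('z \<times> 'z) set \<Rightarrow> ('a set + 'a set) set \<Rightarrow> nat" where
  "mono_homs Z E U = (\<Sum>u \<in> Z. cnt Z E (carrier G) U u)"

lemma finite_V [simp]: "finite V"
  using fin by (simp add: V_def cosets_eq)

lemma V_I: "w \<in> carrier G \<Longrightarrow> Inl (coset I w) \<in> V" and V_J: "w \<in> carrier G \<Longrightarrow> Inr (coset J w) \<in> V"
  by (auto simp: V_def cosets_eq)

lemma V_cases:
  assumes "v \<in> V"
  obtains w where "w \<in> carrier G" "v = Inl (coset I w)" | w where "w \<in> carrier G" "v = Inr (coset J w)"
  using assms by (auto simp: V_def cosets_eq)

lemma act_coset:
  assumes "g \<in> carrier G" "w \<in> carrier G"
  shows "act g (Inl (coset I w)) = Inl (coset I (g \<otimes> w))"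
    and "act g (Inr (coset J w)) = Inr (coset J (g \<otimes> w))"
  using assms coset_mult[OF I] coset_mult[OF J] by (simp_all add: act_def)

lemma act_V: "g \<in> carrier G \<Longrightarrow> v \<in> V \<Longrightarrow> act g v \<in> V"
  by (erule V_cases) (auto simp: act_coset V_I V_J)

lemma act_act: "g \<in> carrier G \<Longrightarrow> h \<in> carrier G \<Longrightarrow> v \<in> V \<Longrightarrow> act g (act h v) = act (g \<otimes> h) v"
  by (erule V_cases) (auto simp: act_coset m_assoc)

lemma act_one: "v \<in> V \<Longrightarrow> act \<one> v = v"
  by (erule V_cases) (auto simp: act_coset)

lemma half_coset:
  assumes "w \<in> side s b"
  shows "Inl (coset I w) \<in> half s b" "Inr (coset J w) \<in> half s b"
  using assms meets_coset[OF I, of w s] meets_coset[OF J, of w s]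
  by (auto simp: half_def side_def V_I V_J)

lemma V_half: "V = half s False \<union> half s True"
proof -
  have "v \<in> half s False \<union> half s True" if "v \<in> V" for v
    using that
  proof (cases rule: V_cases)
    case (1 w)
    then show ?thesis using half_coset[of w s "neg s w"] by (cases "neg s w") (auto simp: side_def)
  next
    case (2 w)
    then show ?thesis using half_coset[of w s "neg s w"] by (cases "neg s w") (auto simp: side_def)
  qed
  then show ?thesis by (auto simp: half_def)
qed

lemma act_half: "s \<in> S \<Longrightarrow> act s ` half s b \<subseteq> half s (\<not> b)"
proof
  fix v assume s: "s \<in> S" and "v \<in> act s ` half s b"
  then obtain x where x: "x \<in> V" "meets (case_sum id id x) s b" "v = act s x" by (auto simp: half_def)
  from x(1) show "v \<in> half s (\<not> b)"
  proof (cases rule: V_cases)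
    case (1 w)
    then show ?thesis using x s meets_mult[OF s, of "coset I w" "\<not> b"] coset_carrier[OF I] act_V[of s x]
      by (auto simp: half_def act_def)
  next
    case (2 w)
    then show ?thesis using x s meets_mult[OF s, of "coset J w" "\<not> b"] coset_carrier[OF J] act_V[of s x]
      by (auto simp: half_def act_def)
  qed
qed

lemma act_fixed:
  assumes s: "s \<in> S" and v: "v \<in> half s False" "v \<in> half s True"
  shows "act s v = v"
proof -
  have "v \<in> V" using v by (simp add: half_def)
  then show ?thesis
  proof (cases rule: V_cases)
    case (1 w)
    then show ?thesis using v coset_meets_both[OF I s, of "coset I w"]
      by (auto simp: half_def act_def cosets_eq)
  next
    case (2 w)
    then show ?thesis using v coset_meets_both[OF J s, of "coset J w"]
      by (auto simp: half_def act_def cosets_eq)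
  qed
qed

text \<open>Each label lies on one side and constrains only vertices of that closed half, so the
  condition splits as \<open>fold_Cauchy_Schwarz\<close> demands. Imposing one of the two conditions
  on a map and on its mirror image amounts to folding \<open>F\<close> and \<open>U\<close>.\<close>

lemma cnt_fold:
  fixes Z :: "'z set"
  assumes s: "s \<in> S" and F: "F \<subseteq> carrier G" and U: "U \<subseteq> V" and Z: "finite Z"
  shows "(cnt Z E F U u)\<^sup>2 \<le>
    cnt Z E (wfold s False F) (vfold s False U) u * cnt Z E (wfold s True F) (vfold s True U) u"
proof -
  define P where "P b f \<longleftrightarrow> edges_ok E (F \<inter> side s b) f \<and> (\<forall>x \<in> U \<inter> half s b. f x = u)"
    for b and f :: "'a set + 'a set \<Rightarrow> 'z"
  have U_eq: "U = U \<inter> half s False \<union> U \<inter> half s True" using U V_half[of s] by auto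
  have un: "edges_ok E (F1 \<union> F2) f \<longleftrightarrow> edges_ok E F1 f \<and> edges_ok E F2 f"
    for F1 F2 and f :: "'a set + 'a set \<Rightarrow> 'z" by (auto simp: edges_ok_def)
  have both: "P False f \<and> P True f \<longleftrightarrow> edges_ok E F f \<and> (\<forall>x \<in> U. f x = u)" for f
  proof -
    have "edges_ok E F f \<longleftrightarrow> edges_ok E (F \<inter> side s False) f \<and> edges_ok E (F \<inter> side s True) f"
      using F unfolding edges_ok_def side_def by blast
    moreover have "(\<forall>x \<in> U. f x = u) \<longleftrightarrow> (\<forall>x \<in> U \<inter> half s False. f x = u) \<and> (\<forall>x \<in> U \<inter> half s True. f x = u)"
      using U_eq by blast
    ultimately show ?thesis unfolding P_def by blast
  qed
  have loc: "P b f = P b g" if "\<And>v. v \<in> half s b \<Longrightarrow> f v = g v" for b f g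
  proof -
    have "edges_ok E (F \<inter> side s b) f = edges_ok E (F \<inter> side s b) g"
      unfolding edges_ok_def using that half_coset[of _ s b] by (intro ball_cong) auto
    moreover have "(\<forall>x \<in> U \<inter> half s b. f x = u) = (\<forall>x \<in> U \<inter> half s b. g x = u)"
      using that by auto
    ultimately show ?thesis by (simp add: P_def)
  qed
  have act_edges: "edges_ok E F' (\<lambda>v. f (act s v)) \<longleftrightarrow> edges_ok E ((\<otimes>) s ` F') f"
    if "F' \<subseteq> carrier G" for F' and f :: "'a set + 'a set \<Rightarrow> 'z"
    using that s by (auto simp: edges_ok_def act_coset subset_iff)
  have dbl: "P b f \<and> P b (\<lambda>v. f (act s v)) \<longleftrightarrow>
      edges_ok E (wfold s b F) f \<and> (\<forall>x \<in> vfold s b U. f x = u)" for b f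
  proof -
    have "edges_ok E (F \<inter> side s b) (\<lambda>v. f (act s v)) \<longleftrightarrow> edges_ok E ((\<otimes>) s ` (F \<inter> side s b)) f"
      using F by (intro act_edges) auto
    moreover have "(\<forall>x \<in> act s ` (U \<inter> half s b). f x = u) \<longleftrightarrow> (\<forall>x \<in> U \<inter> half s b. f (act s x) = u)"
      by blast
    ultimately show ?thesis unfolding wfold_def vfold_def un P_def ball_Un by blast
  qed
  have "(card {f \<in> V \<rightarrow>\<^sub>E Z. P False f \<and> P True f})\<^sup>2 \<le>
    card {f \<in> V \<rightarrow>\<^sub>E Z. P False f \<and> P False (\<lambda>v. f (act s v))} *
    card {f \<in> V \<rightarrow>\<^sub>E Z. P True f \<and> P True (\<lambda>v. f (act s v))}"
  proof (rule fold_Cauchy_Schwarz[where L = "half s False" and R = "half s True"])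
    show "V = half s False \<union> half s True" by (rule V_half)
    show "act s ` half s False \<subseteq> half s True" "act s ` half s True \<subseteq> half s False"
      using act_half[OF s, of False] act_half[OF s, of True] by simp_all
    show "act s (act s v) = v" if "v \<in> V" for v
      using that s by (simp add: act_act gens_sq act_one)
    show "act s v = v" if "v \<in> half s False" "v \<in> half s True" for v
      using act_fixed[OF s that] .
    show "P False f = P False g" if "\<And>v. v \<in> half s False \<Longrightarrow> f v = g v" for f g
      using that by (rule loc)
    show "P True f = P True g" if "\<And>v. v \<in> half s True \<Longrightarrow> f v = g v" for f g
      using that by (rule loc)
  qed (simp_all add: Z)
  then show ?thesis unfolding cnt_def both dbl .
qed

lemma wfold_carrier: "s \<in> S \<Longrightarrow> wfold s b (carrier G) = carrier G"
proof
  assume s: "s \<in> S"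
  then show "wfold s b (carrier G) \<subseteq> carrier G" by (rule wfold_closed)
  show "carrier G \<subseteq> wfold s b (carrier G)"
  proof
    fix w assume w: "w \<in> carrier G"
    have "w \<in> side s b \<or> s \<otimes> w \<in> side s b"
      using w s neg_mult_left[OF s w] by (auto simp: side_def)
    moreover have "w = s \<otimes> (s \<otimes> w)" using w s by simp
    ultimately show "w \<in> wfold s b (carrier G)"
      using w s unfolding wfold_def by (metis IntI UnI1 UnI2 gen_closed image_eqI m_closed)
  qed
qed

lemma finite_maps [simp]: "finite Z \<Longrightarrow> finite {f \<in> V \<rightarrow>\<^sub>E Z. P f}"
  by (simp add: finite_PiE)

text \<open>The full label set is invariant under folding, so only \<open>U\<close> changes. A
  second Cauchy-Schwarz, over the common value \<open>u\<close>, passes from the bounds for single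
  \<open>u\<close> to the sums.\<close>

lemma mono_homs_fold:
  assumes s: "s \<in> S" and U: "U \<subseteq> V" and Z: "finite Z"
  shows "(mono_homs Z E U)\<^sup>2 \<le> mono_homs Z E (vfold s b U) * mono_homs Z E (vfold s (\<not> b) U)"
proof -
  let ?m = "\<lambda>b u. real (cnt Z E (carrier G) (vfold s b U) u)"
  have *: "real (cnt Z E (carrier G) U u) \<le> sqrt (?m b u) * sqrt (?m (\<not> b) u)" for u
  proof -
    have "(cnt Z E (carrier G) U u)\<^sup>2 \<le>
        cnt Z E (carrier G) (vfold s b U) u * cnt Z E (carrier G) (vfold s (\<not> b) U) u"
      using cnt_fold[OF s subset_refl U Z, of E u] s by (cases b) (simp_all add: wfold_carrier mult.commute)
    then have "(real (cnt Z E (carrier G) U u))\<^sup>2 \<le> ?m b u * ?m (\<not> b) u"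
      by (metis of_nat_le_iff of_nat_mult of_nat_power)
    then show ?thesis by (metis real_le_rsqrt real_sqrt_mult)
  qed
  have "(real (mono_homs Z E U))\<^sup>2 \<le> (\<Sum>u\<in>Z. sqrt (?m b u) * sqrt (?m (\<not> b) u))\<^sup>2"
    unfolding mono_homs_def of_nat_sum by (intro power_mono sum_mono * sum_nonneg) auto
  also have "\<dots> \<le> (\<Sum>u\<in>Z. (sqrt (?m b u))\<^sup>2) * (\<Sum>u\<in>Z. (sqrt (?m (\<not> b) u))\<^sup>2)"
    by (rule Cauchy_Schwarz_ineq_sum)
  also have "\<dots> = real (mono_homs Z E (vfold s b U) * mono_homs Z E (vfold s (\<not> b) U))"
    by (simp add: mono_homs_def)
  finally show ?thesis by (metis of_nat_le_iff of_nat_power)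
qed

lemma mono_homs_eq:
  assumes U: "U \<subseteq> V" "U \<noteq> {}" and Z: "finite Z"
  shows "mono_homs Z E U = card {f \<in> V \<rightarrow>\<^sub>E Z. edges_ok E (carrier G) f \<and> (\<exists>u. \<forall>x \<in> U. f x = u)}"
proof -
  obtain x0 where x0: "x0 \<in> U" "x0 \<in> V" using U by auto
  have "{f \<in> V \<rightarrow>\<^sub>E Z. edges_ok E (carrier G) f \<and> (\<exists>u. \<forall>x \<in> U. f x = u)} =
    (\<Union>u \<in> Z. {f \<in> V \<rightarrow>\<^sub>E Z. edges_ok E (carrier G) f \<and> (\<forall>x \<in> U. f x = u)})"
  proof (intro Set.set_eqI iffI)
    fix f assume f: "f \<in> {f \<in> V \<rightarrow>\<^sub>E Z. edges_ok E (carrier G) f \<and> (\<exists>u. \<forall>x \<in> U. f x = u)}"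
    then have "\<forall>x \<in> U. f x = f x0" using x0 by auto
    moreover have "f x0 \<in> Z" using f x0 by auto
    ultimately show "f \<in> (\<Union>u \<in> Z. {f \<in> V \<rightarrow>\<^sub>E Z. edges_ok E (carrier G) f \<and> (\<forall>x \<in> U. f x = u)})"
      using f by auto
  qed auto
  also have "card \<dots> = (\<Sum>u\<in>Z. cnt Z E (carrier G) U u)"
    unfolding cnt_def using Z x0 by (intro card_UN_disjoint) auto
  finally show ?thesis by (simp add: mono_homs_def)
qed

lemma mono_homs_le:
  assumes "U \<subseteq> V" "U \<noteq> {}" "finite Z"
  shows "mono_homs Z E U \<le> homs Z E"
  unfolding mono_homs_eq[OF assms] homs_def using assms(3) by (intro card_mono) auto

lemma bij_act: "g \<in> carrier G \<Longrightarrow> bij_betw (act g) V V"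
  by (rule bij_betw_byWitness[where f' = "act (inv g)"])
     (auto simp: act_act act_one act_V)

lemma mono_homs_shift:
  fixes Z :: "'z set"
  assumes g: "g \<in> carrier G" and U: "U \<subseteq> V"
  shows "mono_homs Z E (act g ` U) = mono_homs Z E U"
proof -
  have "cnt Z E (carrier G) (act g ` U) u = cnt Z E (carrier G) U u" for u
  proof -
    let ?P = "\<lambda>f. edges_ok E (carrier G) f \<and> (\<forall>x \<in> U. f x = u)"
    have loc: "?P f = ?P h" if "\<And>v. v \<in> V \<Longrightarrow> f v = h v" for f h
      using that U V_I V_J by (auto simp: edges_ok_def subset_iff)
    have sur: "carrier G = (\<otimes>) g ` carrier G"
      using g by (metis surj_const_mult)
    have "edges_ok E (carrier G) (\<lambda>v. f (act g v)) \<longleftrightarrow> edges_ok E (carrier G) f" for f :: "'a set + 'a set \<Rightarrow> 'z"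
      by (subst (2) sur) (auto simp: edges_ok_def act_coset g)
    then have sh: "?P (\<lambda>v. f (act g v)) \<longleftrightarrow> edges_ok E (carrier G) f \<and> (\<forall>x \<in> act g ` U. f x = u)" for f
      by auto
    have "card {f \<in> V \<rightarrow>\<^sub>E Z. ?P (\<lambda>v. f (act g v))} = card {f \<in> V \<rightarrow>\<^sub>E Z. ?P f}"
      by (rule card_PiE_reindex[where P = ?P, OF bij_act[OF g]]) (rule loc)
    then show ?thesis unfolding cnt_def by (simp only: sh)
  qed
  then show ?thesis by (simp add: mono_homs_def)
qed

text \<open>Divided by \<open>homs Z E ^ (N + 1)\<close>, this says that a power of the fraction of
  homomorphisms constant on \<open>U\<close> is at most the fraction constant on the whole part. In
  this form it passes backwards through a fold.\<close>

lemma mono_homs_percolation: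
  fixes \<iota> :: "'a set \<Rightarrow> 'a set + 'a set"
  assumes \<iota>: "\<iota> = Inl \<and> K = I \<or> \<iota> = Inr \<and> K = J"
    and K: "S = insert s0 K"
    and U: "U \<subseteq> cosets K" "x \<in> U" "y \<in> U" "x \<noteq> y"
  shows "\<exists>N. \<forall>(Z :: 'z set) E. finite Z \<longrightarrow>
    mono_homs Z E (\<iota> ` U) ^ (N + 1) \<le> homs Z E ^ N * mono_homs Z E (\<iota> ` cosets K)"
proof -
  define Q where "Q U \<longleftrightarrow> (\<exists>N. \<forall>(Z :: 'z set) E. finite Z \<longrightarrow>
    mono_homs Z E (\<iota> ` U) ^ (N + 1) \<le> homs Z E ^ N * mono_homs Z E (\<iota> ` cosets K))" for U
  have KS: "K \<subseteq> S" using \<iota> I J by auto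
  have inV: "\<iota> ` U \<subseteq> V" if "U \<subseteq> cosets K" for U using that \<iota> by (auto simp: V_def)
  have vf: "vfold s b (\<iota> ` U) = \<iota> ` cfold s b U" if "U \<subseteq> cosets K" for s b U
  proof -
    have "\<iota> ` U \<inter> half s b = \<iota> ` {x \<in> U. meets x s b}"
      using inV[OF that] \<iota> by (auto simp: half_def)
    moreover have "act s (\<iota> x) = \<iota> (s <# x)" for x using \<iota> by (auto simp: act_def)
    ultimately show ?thesis unfolding vfold_def cfold_def by (auto simp: image_Un image_image)
  qed
  have "Q U"
  proof (rule vertex_percolation[where Q = Q, OF KS K])
    show "Q (cosets K)" unfolding Q_def by (rule exI[of _ 0]) simp
  next
    fix U s b
    assume U: "U \<subseteq> cosets K" and s: "s \<in> S" and both: "\<And>b. \<exists>x \<in> U. meets x s b"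
      and Q: "Q (cfold s b U)"
    obtain N where N: "mono_homs Z E (\<iota> ` cfold s b U) ^ (N + 1) \<le> homs Z E ^ N * mono_homs Z E (\<iota> ` cosets K)"
      if "finite Z" for Z :: "'z set" and E using Q unfolding Q_def by blast
    show "Q U" unfolding Q_def
    \<comment> \<open>Squaring turns the exponent \<open>N + 1\<close> into
      \<open>2 * (N + 1) = (2 * N + 1) + 1\<close>; the discarded fold, bounded by
      \<open>homs Z E\<close>, supplies the additional \<open>N + 1\<close> factors.\<close>
    proof (intro exI[of _ "2 * N + 1"] allI impI)
      fix Z :: "'z set" and E assume Z: "finite Z"
      have "cfold s (\<not> b) U \<noteq> {}" using both[of "\<not> b"] by (auto simp: cfold_def)
      then have le: "mono_homs Z E (\<iota> ` cfold s (\<not> b) U) \<le> homs Z E"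
        using cfold_closed[OF KS s U] by (intro mono_homs_le inV Z) auto
      have "(mono_homs Z E (\<iota> ` U))\<^sup>2 \<le> mono_homs Z E (\<iota> ` cfold s b U) * mono_homs Z E (\<iota> ` cfold s (\<not> b) U)"
        using mono_homs_fold[OF s inV[OF U] Z, of E b] unfolding vf[OF U] .
      also have "\<dots> \<le> mono_homs Z E (\<iota> ` cfold s b U) * homs Z E" using le by simp
      finally have "((mono_homs Z E (\<iota> ` U))\<^sup>2) ^ (N + 1) \<le> (mono_homs Z E (\<iota> ` cfold s b U) * homs Z E) ^ (N + 1)"
        by (rule power_mono) simp
      also have "\<dots> = mono_homs Z E (\<iota> ` cfold s b U) ^ (N + 1) * homs Z E ^ (N + 1)"
        by (rule power_mult_distrib)
      also have "\<dots> \<le> homs Z E ^ N * mono_homs Z E (\<iota> ` cosets K) * homs Z E ^ (N + 1)"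
        using N[OF Z] by (rule mult_right_mono) simp
      also have "\<dots> = homs Z E ^ (N + (N + 1)) * mono_homs Z E (\<iota> ` cosets K)"
        by (simp only: power_add mult_ac)
      also have "N + (N + 1) = 2 * N + 1" by simp
      also have "((mono_homs Z E (\<iota> ` U))\<^sup>2) ^ (N + 1) = mono_homs Z E (\<iota> ` U) ^ (2 * N + 1 + 1)"
        unfolding power_mult[symmetric] by (simp add: algebra_simps)
      finally show "mono_homs Z E (\<iota> ` U) ^ (2 * N + 1 + 1) \<le> homs Z E ^ (2 * N + 1) * mono_homs Z E (\<iota> ` cosets K)" .
    qed
  next
    fix U g assume U: "U \<subseteq> cosets K" and g: "g \<in> carrier G" and Q: "Q ((<#) g ` U)"
    have "\<iota> ` (<#) g ` U = act g ` \<iota> ` U" using \<iota> by (auto simp: act_def image_image)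
    then show "Q U" using Q unfolding Q_def by (simp add: mono_homs_shift[OF g inV[OF U]])
  qed (use U in auto)
  then show ?thesis unfolding Q_def .
qed

text \<open>Multiplying by the trivial bound raises the exponent, so that finitely many pairs can
  share one exponent.\<close>

lemma mono_homs_power_mono:
  assumes "U \<subseteq> V" "U \<noteq> {}" "finite Z" "N \<le> M"
    and "mono_homs Z E U ^ (N + 1) \<le> homs Z E ^ N * c"
  shows "mono_homs Z E U ^ (M + 1) \<le> homs Z E ^ M * c"
proof -
  obtain k where M: "M = N + k" using assms(4) le_Suc_ex by blast
  have "mono_homs Z E U ^ (M + 1) = mono_homs Z E U ^ (N + 1) * mono_homs Z E U ^ k"
    by (simp add: M power_add)
  also have "\<dots> \<le> (homs Z E ^ N * c) * homs Z E ^ k"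
    using assms(5) mono_homs_le[OF assms(1-3)] by (intro mult_mono power_mono) auto
  finally show ?thesis by (simp add: M power_add mult_ac)
qed

end

lemma card_PiE_pair:
  fixes E :: "('z \<times> 'z) set"
  assumes V: "finite V" "x \<in> V" "y \<in> V" "x \<noteq> y" and Z: "finite Z" "E \<subseteq> Z \<times> Z"
  shows "card E * card Z ^ (card V - 2) \<le> card {f \<in> V \<rightarrow>\<^sub>E Z. (f x, f y) \<in> E}"
proof -
  let ?V = "V - {x, y}"
  have "card (E \<times> (?V \<rightarrow>\<^sub>E Z)) \<le> card {f \<in> V \<rightarrow>\<^sub>E Z. (f x, f y) \<in> E}"
  proof (rule card_inj_on_le[where f = "\<lambda>((a, b), h). h(x := a, y := b)"])
    show "inj_on (\<lambda>((a, b), h). h(x := a, y := b)) (E \<times> (?V \<rightarrow>\<^sub>E Z))"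
    proof (rule inj_onI)
      fix p q assume p: "p \<in> E \<times> (?V \<rightarrow>\<^sub>E Z)" and q: "q \<in> E \<times> (?V \<rightarrow>\<^sub>E Z)"
        and eq: "(\<lambda>((a, b), h). h(x := a, y := b)) p = (\<lambda>((a, b), h). h(x := a, y := b)) q"
      obtain a b h where p': "p = ((a, b), h)" by (metis surj_pair)
      obtain a' b' h' where q': "q = ((a', b'), h')" by (metis surj_pair)
      have e: "(h(x := a, y := b)) v = (h'(x := a', y := b')) v" for v
        using eq p' q' by simp
      have "h v = h' v" for v
      proof (cases "v \<in> ?V")
        case True
        then show ?thesis using e[of v] by auto
      next
        case False
        then show ?thesis using p q p' q' by (auto simp: PiE_def extensional_def)
      qed
      then have "h = h'" by auto
      moreover have "a = a'" using e[of x] V(4) by simp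
      moreover have "b = b'" using e[of y] by simp
      ultimately show "p = q" using p' q' by simp
    qed
    show "(\<lambda>((a, b), h). h(x := a, y := b)) ` (E \<times> (?V \<rightarrow>\<^sub>E Z)) \<subseteq> {f \<in> V \<rightarrow>\<^sub>E Z. (f x, f y) \<in> E}"
      using V Z(2) by (auto simp: PiE_def Pi_def extensional_def)
    show "finite {f \<in> V \<rightarrow>\<^sub>E Z. (f x, f y) \<in> E}" using V Z by (simp add: finite_PiE)
  qed
  moreover have "card (?V \<rightarrow>\<^sub>E Z) = card Z ^ (card V - 2)"
    using V by (simp add: card_PiE card_Diff_subset numeral_2_eq_2)
  ultimately show ?thesis by (simp add: card_cartesian_product)
qed

section \<open>Lower and upper bounds for the number of homomorphisms\<close>

context parabolic_pair
begin

lemma card_wfold: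
  assumes "s \<in> S" "F \<subseteq> carrier G"
  shows "card (wfold s b F) = 2 * card (F \<inter> side s b)"
proof -
  have f: "finite (F \<inter> side s b)" using assms(2) fin by (meson finite_Int finite_subset)
  have "inj_on ((\<otimes>) s) (F \<inter> side s b)"
    using assms by (intro inj_on_subset[OF inj_on_cmult]) auto
  then have "card ((\<otimes>) s ` (F \<inter> side s b)) = card (F \<inter> side s b)" by (rule card_image)
  moreover have "(F \<inter> side s b) \<inter> (\<otimes>) s ` (F \<inter> side s b) = {}"
    using assms neg_mult_left[of s] by (auto simp: side_def)
  ultimately show ?thesis unfolding wfold_def using f by (simp add: card_Un_disjoint)
qed

text \<open>Since \<open>s\<close> exchanges the sides freely, each half of \<open>F\<close>
  doubles. This exact balance makes the denominators match in \<open>edge_density_le\<close>; it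
  holds for labels, as an edge inside a wall has labels on both sides.\<close>

lemma card_wfold_sum:
  assumes "s \<in> S" "F \<subseteq> carrier G"
  shows "card (wfold s False F) + card (wfold s True F) = 2 * card F"
proof -
  have "finite F" using assms(2) fin by (meson finite_subset)
  moreover have "F = F \<inter> side s False \<union> F \<inter> side s True" using assms(2) by (auto simp: side_def)
  moreover have "(F \<inter> side s False) \<inter> (F \<inter> side s True) = {}" by (auto simp: side_def)
  ultimately have "card F = card (F \<inter> side s False) + card (F \<inter> side s True)"
    by (metis card_Un_disjoint finite_Un)
  then show ?thesis using card_wfold[OF assms] by simp
qed

abbreviation K :: "'a set" where
  "K \<equiv> generate G I \<inter> generate G J"

text \<open>Among all edge sets \<open>F\<close> maximise the ratio between the density of \<open>F\<close> and the power
  \<open>|F| / |G|\<close> of the density of the whole graph. By Cauchy-Schwarz both folds of a maximiser are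
  maximisers, so by percolation the maximum is attained at \<open>F = {}\<close> or at the whole graph.\<close>

lemma edge_density_le:
  fixes Z :: "'z set"
  assumes Z: "finite Z" and E: "E \<subseteq> Z \<times> Z" "E \<noteq> {}" and F: "F \<subseteq> carrier G"
  shows "(real (cnt Z E F {} u) / real (card Z) ^ card V) ^ card (carrier G) \<le>
    (real (homs Z E) / real (card Z) ^ card V) ^ card F"
proof -
  define \<tau> where "\<tau> F = real (cnt Z E F {} u) / real (card Z) ^ card V" for F
  \<comment> \<open>The ratio to be maximised, raised to the power \<open>card (carrier G)\<close>
    to keep all exponents natural.\<close>
  define g where "g F = \<tau> F ^ card (carrier G) / \<tau> (carrier G) ^ card F" for F
  obtain a b where ab: "(a, b) \<in> E" "a \<in> Z" "b \<in> Z" using E by auto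
  have n: "card Z > 0" using Z ab by (auto simp: card_gt_0_iff)
  have homs: "homs Z E = cnt Z E (carrier G) {} u" by (simp add: homs_def cnt_def)
  \<comment> \<open>Sending the two parts to the two ends of a single pair of \<open>E\<close>
    satisfies every edge condition.\<close>
  have pos: "\<tau> F > 0" if "F \<subseteq> carrier G" for F
  proof -
    let ?f = "\<lambda>v \<in> V. case_sum (\<lambda>_. a) (\<lambda>_. b) v"
    have "?f \<in> V \<rightarrow>\<^sub>E Z" using ab by (auto split: sum.splits)
    moreover have "edges_ok E F ?f" using ab that by (auto simp: edges_ok_def V_I V_J subset_iff)
    ultimately have "?f \<in> {f \<in> V \<rightarrow>\<^sub>E Z. edges_ok E F f \<and> (\<forall>x \<in> {}. f x = u)}" by simp
    then have "cnt Z E F {} u > 0" 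
      unfolding cnt_def card_gt_0_iff by (intro conjI finite_maps[OF Z]) blast
    then show ?thesis using n by (simp add: \<tau>_def)
  qed
  have gpos: "g F > 0" if "F \<subseteq> carrier G" for F
    using pos[OF that] pos[of "carrier G"] by (simp add: g_def)
  have gfold: "(g F)\<^sup>2 \<le> g (wfold s b F) * g (wfold s (\<not> b) F)"
    if s: "s \<in> S" and F: "F \<subseteq> carrier G" for F s b
  proof -
    have "(cnt Z E F {} u)\<^sup>2 \<le> cnt Z E (wfold s False F) {} u * cnt Z E (wfold s True F) {} u"
      using cnt_fold[OF s F _ Z, of "{}" E u] by (simp add: vfold_def)
    then have "(real (cnt Z E F {} u))\<^sup>2 \<le> real (cnt Z E (wfold s False F) {} u) * real (cnt Z E (wfold s True F) {} u)"
      by (metis of_nat_le_iff of_nat_mult of_nat_power)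
    then have t: "(\<tau> F)\<^sup>2 \<le> \<tau> (wfold s False F) * \<tau> (wfold s True F)"
      unfolding \<tau>_def power_divide times_divide_times_eq power2_eq_square
      by (rule divide_right_mono) simp
    have "(g F)\<^sup>2 = ((\<tau> F)\<^sup>2) ^ card (carrier G) / \<tau> (carrier G) ^ (2 * card F)"
      by (simp add: g_def power_divide mult.commute flip: power_mult)
    also have "\<dots> \<le> (\<tau> (wfold s False F) * \<tau> (wfold s True F)) ^ card (carrier G) / \<tau> (carrier G) ^ (2 * card F)"
      using t pos[of "carrier G"] by (intro divide_right_mono power_mono) auto
    also have "\<dots> = g (wfold s False F) * g (wfold s True F)"
      unfolding card_wfold_sum[OF s F, symmetric] by (simp add: g_def power_mult_distrib power_add)
    finally show ?thesis by (cases b) (simp_all add: mult.commute)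
  qed
  have fin': "finite (g ` Pow (carrier G))" using fin by simp
  define M where "M = Max (g ` Pow (carrier G))"
  have gM: "g F \<le> M" if "F \<subseteq> carrier G" for F
    unfolding M_def using fin' that by (intro Max_ge) auto
  have "M \<in> g ` Pow (carrier G)" unfolding M_def using fin' by (intro Max_in) auto
  then obtain F0 where F0: "F0 \<subseteq> carrier G" "g F0 = M" by auto
  have g_carrier: "g (carrier G) = 1" using pos[of "carrier G"] by (simp add: g_def)
  have "M = 1"
  proof (cases "F0 = {}")
    case True
    have "cnt Z E {} {} u = card Z ^ card V"
      by (simp add: cnt_def edges_ok_def card_PiE)
    then have "\<tau> {} = 1" using n by (simp add: \<tau>_def)
    then show ?thesis using True F0(2) by (simp add: g_def)
  next
    case False
    have "g (carrier G) = M"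
    proof (rule edge_percolation[where Q = "\<lambda>F. g F = M", OF _ F0(1) False F0(2)])
      fix F s b assume F: "F \<subseteq> carrier G" and s: "s \<in> S" and "g F = M"
      then have "M\<^sup>2 \<le> g (wfold s b F) * g (wfold s (\<not> b) F)" using gfold by blast
      also have "\<dots> \<le> g (wfold s b F) * M"
        using gM[OF wfold_closed[OF s]] gpos[OF wfold_closed[OF s]] by (intro mult_left_mono) (auto intro: less_imp_le)
      finally have "M \<le> g (wfold s b F)"
        using gpos[OF F0(1)] F0(2) by (simp add: power2_eq_square)
      then show "g (wfold s b F) = M" using gM[OF wfold_closed[OF s]] by (intro antisym)
    qed
    then show ?thesis using g_carrier by simp
  qed
  then have "g F \<le> 1" using gM[OF F] by simp
  then show ?thesis using pos[of "carrier G"] by (simp add: g_def \<tau>_def homs divide_le_eq)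
qed

lemma card_K_pos: "card K > 0"
proof -
  have "\<one> \<in> K" by (simp add: generate.one)
  moreover have "finite K" using parabolic_carrier[OF I] fin by (meson finite_Int finite_subset)
  ultimately show ?thesis by (auto simp: card_gt_0_iff)
qed

text \<open>\<open>K\<close> labels just the edge through the base chamber, whose density is at
  least \<open>card E / (card Z)\<^sup>2\<close>. For \<open>F = K\<close> the exponents in
  \<open>edge_density_le\<close> are \<open>e * card K\<close> and \<open>card K\<close>; taking the
  root of order \<open>card K\<close> leaves Sidorenko's exponent \<open>e\<close>.\<close>

lemma homs_lower:
  fixes Z :: "'z set"
  assumes Z: "finite Z" and E: "E \<subseteq> Z \<times> Z" "E \<noteq> {}" and e: "e * card K = card (carrier G)"
  shows "real (card Z) ^ card V * (real (card E) / (real (card Z))\<^sup>2) ^ e \<le> real (homs Z E)"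
proof -
  let ?n = "real (card Z)"
  obtain u where u: "u \<in> Z" using E by auto
  have n: "?n > 0" using Z u by (auto simp: card_gt_0_iff)
  have KG: "K \<subseteq> carrier G" using parabolic_carrier[OF I] by auto
  let ?x = "Inl (coset I \<one>)" and ?y = "Inr (coset J \<one>)"
  have V2: "card V \<ge> 2" 
    using card_mono[of V "{?x, ?y}"] V_I[of \<one>] V_J[of \<one>] by simp
  have eo: "edges_ok E K f \<longleftrightarrow> (f ?x, f ?y) \<in> E" for f :: "'a set + 'a set \<Rightarrow> 'z"
  proof -
    have "coset I w = coset I \<one> \<and> coset J w = coset J \<one>" if "w \<in> K" for w
      using that coset_mult_right[OF I one_closed, of w] coset_mult_right[OF J one_closed, of w] KG
      by auto
    moreover have "\<one> \<in> K" by (simp add: generate.one)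
    ultimately show ?thesis unfolding edges_ok_def by metis
  qed
  have "card E * card Z ^ (card V - 2) \<le> cnt Z E K {} u"
    unfolding cnt_def eo using card_PiE_pair[OF finite_V V_I[of \<one>] V_J[of \<one>] _ Z E(1)] by simp
  then have "real (card E) * ?n ^ (card V - 2) \<le> real (cnt Z E K {} u)"
    by (metis of_nat_le_iff of_nat_mult of_nat_power)
  then have "real (card E) * ?n ^ (card V - 2) / ?n ^ card V \<le> real (cnt Z E K {} u) / ?n ^ card V"
    by (rule divide_right_mono) simp
  moreover have "?n ^ card V = ?n ^ (card V - 2) * ?n\<^sup>2"
    using V2 by (metis le_add_diff_inverse2 power_add)
  ultimately have *: "real (card E) / ?n\<^sup>2 \<le> real (cnt Z E K {} u) / ?n ^ card V" using n by simp
  have "((real (card E) / ?n\<^sup>2) ^ e) ^ card K = (real (card E) / ?n\<^sup>2) ^ card (carrier G)"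
    by (simp add: e flip: power_mult)
  also have "\<dots> \<le> (real (cnt Z E K {} u) / ?n ^ card V) ^ card (carrier G)"
    using * by (intro power_mono) auto
  also have "\<dots> \<le> (real (homs Z E) / ?n ^ card V) ^ card K"
    by (rule edge_density_le[OF Z E KG])
  finally have "(real (card E) / ?n\<^sup>2) ^ e \<le> real (homs Z E) / ?n ^ card V"
    using card_K_pos by (simp add: power_mono_iff)
  then show ?thesis using n by (simp add: le_divide_eq mult.commute)
qed

text \<open>Once one part is sent to \<open>u\<close>, each vertex of the other part, lying on some
  edge, must go to one of at most \<open>D\<close> neighbours of \<open>u\<close>.\<close>

lemma mono_homs_part_le:
  fixes Z :: "'z set"
  assumes Z: "finite Z" and E: "E \<subseteq> Z \<times> Z"
  shows "(\<And>u. card {y. (u, y) \<in> E} \<le> D) \<Longrightarrow>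
      mono_homs Z E (Inl ` cosets I) \<le> card Z * D ^ card (cosets J)"
    and "(\<And>u. card {y. (y, u) \<in> E} \<le> D) \<Longrightarrow>
      mono_homs Z E (Inr ` cosets J) \<le> card Z * D ^ card (cosets I)"
proof -
  have gen: "card {f \<in> V \<rightarrow>\<^sub>E Z. edges_ok E (carrier G) f \<and> (\<forall>x \<in> A. f x = u)} \<le> D ^ card B"
    if V: "V = A \<union> B" and B: "finite B" and N: "finite N" "card N \<le> D"
      and BN: "\<And>f x. edges_ok E (carrier G) f \<Longrightarrow> (\<forall>x \<in> A. f x = u) \<Longrightarrow> x \<in> B \<Longrightarrow> f x \<in> N"
    for A B u N
  proof -
    have "card {f \<in> V \<rightarrow>\<^sub>E Z. edges_ok E (carrier G) f \<and> (\<forall>x \<in> A. f x = u)} \<le> card (B \<rightarrow>\<^sub>E N)"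
    proof (rule card_inj_on_le[where f = "\<lambda>f. restrict f B"])
      show "inj_on (\<lambda>f. restrict f B) {f \<in> V \<rightarrow>\<^sub>E Z. edges_ok E (carrier G) f \<and> (\<forall>x \<in> A. f x = u)}"
      proof (rule inj_onI)
        fix f h assume f: "f \<in> {f \<in> V \<rightarrow>\<^sub>E Z. edges_ok E (carrier G) f \<and> (\<forall>x \<in> A. f x = u)}"
          and h: "h \<in> {f \<in> V \<rightarrow>\<^sub>E Z. edges_ok E (carrier G) f \<and> (\<forall>x \<in> A. f x = u)}"
          and eq: "restrict f B = restrict h B"
        show "f = h"
        proof (rule PiE_ext[of f V "\<lambda>_. Z" h])
          fix v assume "v \<in> V"
          then consider "v \<in> A" | "v \<in> B" using V by auto
          then show "f v = h v"
          proof cases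
            case 2
            then show ?thesis using fun_cong[OF eq, of v] by simp
          qed (use f h in auto)
        qed (use f h in auto)
      qed
      show "(\<lambda>f. restrict f B) ` {f \<in> V \<rightarrow>\<^sub>E Z. edges_ok E (carrier G) f \<and> (\<forall>x \<in> A. f x = u)} \<subseteq> B \<rightarrow>\<^sub>E N"
        using BN by (intro image_subsetI) auto
      show "finite (B \<rightarrow>\<^sub>E N)" using B N by (simp add: finite_PiE)
    qed
    also have "\<dots> = card N ^ card B" using B by (simp add: card_PiE)
    also have "\<dots> \<le> D ^ card B" using N by (intro power_mono) auto
    finally show ?thesis .
  qed
  have finE: "finite E" using E Z by (meson finite_SigmaI finite_subset)
  have fins: "finite (cosets I)" "finite (cosets J)" using fin by (simp_all add: cosets_eq)
  {
    assume D: "\<And>u. card {y. (u, y) \<in> E} \<le> D"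
    have "cnt Z E (carrier G) (Inl ` cosets I) u \<le> D ^ card (cosets J)" for u
    proof -
      have "cnt Z E (carrier G) (Inl ` cosets I) u \<le> D ^ card (Inr ` cosets J :: ('a set + 'a set) set)"
        unfolding cnt_def
      proof (rule gen[of "Inl ` cosets I" "Inr ` cosets J" "{y. (u, y) \<in> E}"])
        show "V = Inl ` cosets I \<union> Inr ` cosets J" by (auto simp: V_def)
        show "finite {y. (u, y) \<in> E}"
          using finE by (rule finite_subset[rotated, OF finite_imageI[of E snd]]) force
        show "f x \<in> {y. (u, y) \<in> E}" if "edges_ok E (carrier G) f" "\<forall>x \<in> Inl ` cosets I. f x = u"
          "x \<in> Inr ` cosets J" for f x
          using that by (auto simp: edges_ok_def cosets_eq)
      qed (use D fins in auto)
      then show ?thesis by (simp add: card_image)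
    qed
    then have "mono_homs Z E (Inl ` cosets I) \<le> (\<Sum>u\<in>Z. D ^ card (cosets J))"
      unfolding mono_homs_def by (intro sum_mono)
    then show "mono_homs Z E (Inl ` cosets I) \<le> card Z * D ^ card (cosets J)" by simp
  }
  {
    assume D: "\<And>u. card {y. (y, u) \<in> E} \<le> D"
    have "cnt Z E (carrier G) (Inr ` cosets J) u \<le> D ^ card (cosets I)" for u
    proof -
      have "cnt Z E (carrier G) (Inr ` cosets J) u \<le> D ^ card (Inl ` cosets I :: ('a set + 'a set) set)"
        unfolding cnt_def
      proof (rule gen[of "Inr ` cosets J" "Inl ` cosets I" "{y. (y, u) \<in> E}"])
        show "V = Inr ` cosets J \<union> Inl ` cosets I" by (auto simp: V_def)
        show "finite {y. (y, u) \<in> E}"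
          using finE by (rule finite_subset[rotated, OF finite_imageI[of E fst]]) force
        show "f x \<in> {y. (y, u) \<in> E}" if "edges_ok E (carrier G) f" "\<forall>x \<in> Inr ` cosets J. f x = u"
          "x \<in> Inl ` cosets I" for f x
          using that by (auto simp: edges_ok_def cosets_eq)
      qed (use D fins in auto)
      then show ?thesis by (simp add: card_image)
    qed
    then have "mono_homs Z E (Inr ` cosets J) \<le> (\<Sum>u\<in>Z. D ^ card (cosets I))"
      unfolding mono_homs_def by (intro sum_mono)
    then show "mono_homs Z E (Inr ` cosets J) \<le> card Z * D ^ card (cosets I)" by simp
  }
qed

text \<open>Every homomorphism merges two vertices, and these lie in one part because
  \<open>X\<close> and \<open>Y\<close> are disjoint. So some pair of \<open>prs\<close> is merged
  by at least \<open>homs Z E / card prs\<close> homomorphisms; percolation raises this to the power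
  \<open>N + 1\<close>, and cancelling \<open>homs Z E ^ N\<close> leaves the constant
  \<open>card prs ^ (N + 1)\<close>.\<close>

lemma homs_upper:
  assumes SI: "S = insert s0 I" and SJ: "S = insert t0 J"
  shows "\<exists>C :: nat. \<forall>(Z :: 'z set) E X Y. finite Z \<longrightarrow> E \<subseteq> X \<times> Y \<longrightarrow> X \<inter> Y = {} \<longrightarrow>
      (\<forall>f \<in> V \<rightarrow>\<^sub>E Z. inj_on f V \<longrightarrow> \<not> edges_ok E (carrier G) f) \<longrightarrow>
      homs Z E \<le> C * max (mono_homs Z E (Inl ` cosets I)) (mono_homs Z E (Inr ` cosets J))"
proof -
  define A where "A = (Inl ` cosets I :: ('a set + 'a set) set)"
  define B where "B = (Inr ` cosets J :: ('a set + 'a set) set)"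
  define top where "top Z E = max (mono_homs Z E A) (mono_homs Z E B)" for Z :: "'z set" and E
  define prs where "prs = {p \<in> V \<times> V. fst p \<noteq> snd p \<and> (p \<in> A \<times> A \<or> p \<in> B \<times> B)}"
  have finprs: "finite prs" unfolding prs_def by simp
  have "\<forall>p \<in> prs. \<exists>N. \<forall>(Z :: 'z set) E. finite Z \<longrightarrow>
    mono_homs Z E {fst p, snd p} ^ (N + 1) \<le> homs Z E ^ N * top Z E"
  proof
    fix p assume p: "p \<in> prs"
    then consider x y where "p = (Inl x, Inl y)" "x \<in> cosets I" "y \<in> cosets I" "x \<noteq> y"
      | x y where "p = (Inr x, Inr y)" "x \<in> cosets J" "y \<in> cosets J" "x \<noteq> y"
      unfolding prs_def A_def B_def by fastforce
    then show "\<exists>N. \<forall>(Z :: 'z set) E. finite Z \<longrightarrow>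
      mono_homs Z E {fst p, snd p} ^ (N + 1) \<le> homs Z E ^ N * top Z E"
    proof cases
      case 1
      obtain N where N: "\<And>(Z :: 'z set) E. finite Z \<Longrightarrow>
          mono_homs Z E (Inl ` {x, y}) ^ (N + 1) \<le> homs Z E ^ N * mono_homs Z E (Inl ` cosets I)"
        using mono_homs_percolation[of Inl I s0 "{x, y}" x y] SI 1 by auto
      have "mono_homs Z E {fst p, snd p} ^ (N + 1) \<le> homs Z E ^ N * top Z E" if "finite Z" for Z :: "'z set" and E
        using order_trans[OF N[OF that, of E] mult_le_mono2[of _ "top Z E"]] 1 by (simp add: top_def A_def)
      then show ?thesis by blast
    next
      case 2
      obtain N where N: "\<And>(Z :: 'z set) E. finite Z \<Longrightarrow>
          mono_homs Z E (Inr ` {x, y}) ^ (N + 1) \<le> homs Z E ^ N * mono_homs Z E (Inr ` cosets J)"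
        using mono_homs_percolation[of Inr J t0 "{x, y}" x y] SJ 2 by auto
      have "mono_homs Z E {fst p, snd p} ^ (N + 1) \<le> homs Z E ^ N * top Z E" if "finite Z" for Z :: "'z set" and E
        using order_trans[OF N[OF that, of E] mult_le_mono2[of _ "top Z E"]] 2 by (simp add: top_def B_def)
      then show ?thesis by blast
    qed
  qed
  then obtain Np where Np: "\<And>p (Z :: 'z set) E. p \<in> prs \<Longrightarrow> finite Z \<Longrightarrow>
      mono_homs Z E {fst p, snd p} ^ (Np p + 1) \<le> homs Z E ^ Np p * top Z E"
    by metis
  define N where "N = sum Np prs"
  have N: "mono_homs Z E {fst p, snd p} ^ (N + 1) \<le> homs Z E ^ N * top Z E"
    if "p \<in> prs" "finite Z" for p and Z :: "'z set" and E
  proof (rule mono_homs_power_mono[OF _ _ that(2) _ Np[OF that]])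
    show "{fst p, snd p} \<subseteq> V" using that(1) by (auto simp: prs_def)
    show "Np p \<le> N" unfolding N_def using finprs that(1) by (intro member_le_sum) auto
  qed simp
  show ?thesis
  proof (intro exI[of _ "card prs ^ (N + 1)"] allI impI)
    fix Z :: "'z set" and E X Y
    assume Z: "finite Z" and E: "E \<subseteq> X \<times> Y" "X \<inter> Y = {}"
      and free: "\<forall>f \<in> V \<rightarrow>\<^sub>E Z. inj_on f V \<longrightarrow> \<not> edges_ok E (carrier G) f"
    let ?H = "{f \<in> V \<rightarrow>\<^sub>E Z. edges_ok E (carrier G) f}"
    let ?D = "\<lambda>p. {f \<in> V \<rightarrow>\<^sub>E Z. edges_ok E (carrier G) f \<and> (\<exists>u. \<forall>x \<in> {fst p, snd p}. f x = u)}"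
    have "?H \<subseteq> (\<Union>p \<in> prs. ?D p)"
    proof
      fix f assume f: "f \<in> ?H"
      then have "\<not> inj_on f V" using free by auto
      then obtain x y where xy: "x \<in> V" "y \<in> V" "x \<noteq> y" "f x = f y" by (auto simp: inj_on_def)
      have "f v \<in> X" if "v \<in> A" for v using f that E(1) by (auto simp: A_def edges_ok_def cosets_eq)
      moreover have "f v \<in> Y" if "v \<in> B" for v using f that E(1) by (auto simp: B_def edges_ok_def cosets_eq)
      moreover have "V = A \<union> B" by (auto simp: V_def A_def B_def)
      ultimately have "(x, y) \<in> prs" using xy E(2) unfolding prs_def by (auto; metis IntI empty_iff)
      then show "f \<in> (\<Union>p \<in> prs. ?D p)" using f xy(4) by (intro UN_I[of "(x, y)"]) auto
    qed
    then have "homs Z E \<le> card (\<Union>p \<in> prs. ?D p)"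
      unfolding homs_def using Z finprs by (intro card_mono) auto
    also have "\<dots> \<le> (\<Sum>p\<in>prs. card (?D p))" by (rule card_UN_le[OF finprs])
    also have "\<dots> = (\<Sum>p\<in>prs. mono_homs Z E {fst p, snd p})"
      by (intro sum.cong refl mono_homs_eq[OF _ _ Z, symmetric]) (auto simp: prs_def)
    finally have le: "homs Z E \<le> (\<Sum>p\<in>prs. mono_homs Z E {fst p, snd p})" .
    have "homs Z E \<le> card prs ^ (N + 1) * top Z E"
    proof (cases "homs Z E = 0")
      case False
      have "prs \<noteq> {}" using False le by auto
      define m where "m = Max ((\<lambda>p. mono_homs Z E {fst p, snd p}) ` prs)"
      have "m \<in> (\<lambda>p. mono_homs Z E {fst p, snd p}) ` prs"
        unfolding m_def using finprs \<open>prs \<noteq> {}\<close> by (intro Max_in) auto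
      then have m: "m ^ (N + 1) \<le> homs Z E ^ N * top Z E" using N[OF _ Z] by auto
      have "(\<Sum>p\<in>prs. mono_homs Z E {fst p, snd p}) \<le> card prs * m"
        unfolding m_def using finprs by (intro sum_bounded_above[where 'a = nat, simplified]) auto
      then have "homs Z E ^ (N + 1) \<le> (card prs * m) ^ (N + 1)" using le by (intro power_mono) auto
      also have "\<dots> = card prs ^ (N + 1) * m ^ (N + 1)" by (rule power_mult_distrib)
      also have "\<dots> \<le> card prs ^ (N + 1) * (homs Z E ^ N * top Z E)" using m by (rule mult_le_mono2)
      finally have "homs Z E ^ N * homs Z E \<le> homs Z E ^ N * (card prs ^ (N + 1) * top Z E)"
        by (simp add: mult_ac)
      then show ?thesis using False by simp
    qed simp
    then show "homs Z E \<le> card prs ^ (N + 1) * max (mono_homs Z E (Inl ` cosets I)) (mono_homs Z E (Inr ` cosets J))"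
      by (simp add: top_def A_def B_def)
  qed
qed

end

section \<open>Cuts and almost regular subgraphs\<close>

text \<open>Vertices are added one at a time, each to the side that holds at most half of its
  earlier neighbours. The cut is counted in pairs directed from \<open>X\<close> to its complement,
  the form of host used for homomorphisms.\<close>

lemma max_cut:
  assumes "finite V" "F \<subseteq> [V]\<^bsup>2\<^esup>"
  shows "\<exists>X \<subseteq> V. card F \<le> 2 * card {(u, v). u \<in> X \<and> v \<in> V - X \<and> {u, v} \<in> F}"
  using assms
proof (induction V arbitrary: F rule: finite_induct)
  case empty
  then have "F = {}" by (auto simp: nsets_def)
  then show ?case by simp
next
  case (insert x V)
  let ?F = "{e \<in> F. x \<notin> e}"
  let ?N = "{v \<in> V. {x, v} \<in> F}"
  let ?cut = "\<lambda>A B F. {(u, v). u \<in> A \<and> v \<in> B \<and> {u, v} \<in> F}"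
  have F': "?F \<subseteq> [V]\<^bsup>2\<^esup>" using insert.prems by (auto simp: nsets_def)
  obtain X where X: "X \<subseteq> V" "card ?F \<le> 2 * card (?cut X (V - X) ?F)"
    using insert.IH[OF F'] by auto
  have finN: "finite ?N" using insert.hyps by simp
  have fincut: "finite (?cut A B F'')" if "A \<subseteq> insert x V" "B \<subseteq> insert x V" for A B F''
    by (rule finite_subset[of _ "insert x V \<times> insert x V"]) (use that insert.hyps in auto)
  have "F \<subseteq> ?F \<union> (\<lambda>v. {x, v}) ` ?N"
  proof
    fix e assume e: "e \<in> F"
    then obtain a b where ab: "e = {a, b}" "a \<noteq> b" "a \<in> insert x V" "b \<in> insert x V"
      using insert.prems by (auto simp: nsets_def card_2_iff)
    show "e \<in> ?F \<union> (\<lambda>v. {x, v}) ` ?N"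
    proof (cases "x \<in> e")
      case True
      then consider "e = {x, b}" "b \<in> V" | "e = {x, a}" "a \<in> V" using ab by auto
      then show ?thesis using e by cases auto
    qed (use e in auto)
  qed
  moreover have "finite (?F \<union> (\<lambda>v. {x, v}) ` ?N)"
  proof -
    have "finite ?F" using F' insert.hyps finite_imp_finite_nsets finite_subset by blast
    then show ?thesis using finN by blast
  qed
  ultimately have "card F \<le> card (?F \<union> (\<lambda>v. {x, v}) ` ?N)" by (rule card_mono[rotated])
  also have "\<dots> \<le> card ?F + card ((\<lambda>v. {x, v}) ` ?N)" by (rule card_Un_le)
  also have "\<dots> \<le> card ?F + card ?N" using card_image_le[OF finN] by simp
  finally have cF: "card F \<le> card ?F + card ?N" .
  have cN: "card ?N = card (?N \<inter> X) + card (?N - X)"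
    by (rule card_Int_Diff[OF finN])
  show ?case
  proof (cases "card (?N - X) \<le> card (?N \<inter> X)")
    case True
    let ?new = "(\<lambda>u. (u, x)) ` (?N \<inter> X)"
    have "?cut X (V - X) ?F \<union> ?new \<subseteq> ?cut X (insert x V - X) F"
      using X insert.hyps by (auto simp: insert_commute)
    then have "card (?cut X (V - X) ?F \<union> ?new) \<le> card (?cut X (insert x V - X) F)"
      using X by (intro card_mono fincut) auto
    moreover have "card (?cut X (V - X) ?F \<union> ?new) = card (?cut X (V - X) ?F) + card ?new"
      using finN X insert.hyps by (intro card_Un_disjoint fincut) auto
    moreover have "card ?new = card (?N \<inter> X)" by (rule card_image) (auto simp: inj_on_def)
    ultimately show ?thesis using X cF cN True by (intro exI[of _ X]) auto
  next
    case False
    let ?new = "(\<lambda>u. (x, u)) ` (?N - X)"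
    have "?cut X (V - X) ?F \<union> ?new \<subseteq> ?cut (insert x X) (insert x V - insert x X) F"
      using X insert.hyps by auto
    then have "card (?cut X (V - X) ?F \<union> ?new) \<le> card (?cut (insert x X) (insert x V - insert x X) F)"
      using X by (intro card_mono fincut) auto
    moreover have "card (?cut X (V - X) ?F \<union> ?new) = card (?cut X (V - X) ?F) + card ?new"
      using finN X insert.hyps by (intro card_Un_disjoint fincut) auto
    moreover have "card ?new = card (?N - X)" by (rule card_image) (auto simp: inj_on_def)
    ultimately show ?thesis using X cF cN False by (intro exI[of _ "insert x X"]) auto
  qed
qed

lemma sum_degree_le:
  assumes "finite P" "E \<subseteq> P \<times> P"
  shows "(\<Sum>v\<in>P. card {e \<in> E. fst e = v \<or> snd e = v}) \<le> 2 * card E"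
proof -
  have finE: "finite E" using assms by (meson finite_SigmaI finite_subset)
  have part: "(\<Sum>v\<in>P. card {e \<in> E. h e = v}) = card E" if "h ` E \<subseteq> P" for h :: "'a \<times> 'a \<Rightarrow> 'a"
  proof -
    have "E = (\<Union>v\<in>P. {e \<in> E. h e = v})" using that by auto
    then have "card E = card (\<Union>v\<in>P. {e \<in> E. h e = v})" by simp
    also have "\<dots> = (\<Sum>v\<in>P. card {e \<in> E. h e = v})"
      using assms(1) finE by (intro card_UN_disjoint) auto
    finally show ?thesis by simp
  qed
  have "(\<Sum>v\<in>P. card {e \<in> E. fst e = v \<or> snd e = v}) \<le>
      (\<Sum>v\<in>P. card {e \<in> E. fst e = v} + card {e \<in> E. snd e = v})"
    by (intro sum_mono order_trans[OF card_mono card_Un_le]) (use finE in auto)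
  also have "\<dots> = 2 * card E"
    using part[of fst] part[of snd] assms(2) by (simp add: sum.distrib) force
  finally show ?thesis .
qed

text \<open>Take a vertex set \<open>Q\<close> that maximises \<open>|E[Q]| / |Q| powr (1 + \<epsilon>)\<close>. If more than half of the
  edges of \<open>E[Q]\<close> met the small set \<open>T\<close> of vertices of large degree, then \<open>T\<close> together with one
  part of an equipartition of \<open>Q\<close> would have a larger ratio; so the edges meeting \<open>T\<close> can be
  deleted.\<close>

lemma almost_regular_subgraph:
  assumes \<epsilon>: "0 < \<epsilon>" "\<epsilon> \<le> 1"
  shows "\<exists>K \<ge> 1. \<forall>(E :: ('v \<times> 'v) set) P C. finite P \<longrightarrow> P \<noteq> {} \<longrightarrow> E \<subseteq> P \<times> P \<longrightarrow> C \<ge> K \<longrightarrow>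
    C * real (card P) powr (1 + \<epsilon>) \<le> real (card E) \<longrightarrow>
    (\<exists>Q E'. Q \<subseteq> P \<and> Q \<noteq> {} \<and> E' \<subseteq> E \<and> E' \<subseteq> Q \<times> Q \<and>
      C / 2 * real (card Q) powr (1 + \<epsilon>) \<le> real (card E') \<and>
      (\<forall>v. real (card {e \<in> E'. fst e = v \<or> snd e = v}) \<le> K * real (card E') / real (card Q)))"
proof -
  \<comment> \<open>The number of parts of \<open>Q\<close>. Each part together with
    \<open>T\<close> will have at most \<open>3 * m / q\<close> vertices, so all \<open>q\<close> of
    them span at most the fraction \<open>q * (3 / q) powr (1 + \<epsilon>) \<le> 9 / q powr
    \<epsilon>\<close> of the edges; \<open>18\<close> makes this one half.\<close>
  define q where "q = nat \<lceil>18 powr (1 / \<epsilon>)\<rceil>"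
  have "(1::real) \<le> 18 powr (1 / \<epsilon>)" using \<epsilon> by (simp add: ge_one_powr_ge_zero)
  then have q: "q \<ge> 1" "18 powr (1 / \<epsilon>) \<le> real q" unfolding q_def by linarith+
  have "(18 powr (1 / \<epsilon>)) powr \<epsilon> \<le> real q powr \<epsilon>" using q(2) \<epsilon> by (intro powr_mono2) auto
  then have q18: "18 \<le> real q powr \<epsilon>" using \<epsilon> by (simp add: powr_powr)
  show ?thesis
  proof (intro exI[of _ "4 * real q"] conjI allI impI)
    show "4 * real q \<ge> 1" using q by simp
    fix E :: "('v \<times> 'v) set" and P :: "'v set" and C :: real
    assume P: "finite P" "P \<noteq> {}" "E \<subseteq> P \<times> P" and C: "C \<ge> 4 * real q"
      and dense: "C * real (card P) powr (1 + \<epsilon>) \<le> real (card E)"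
    define ind where "ind Q = E \<inter> Q \<times> Q" for Q
    define r where "r Q = real (card (ind Q)) / real (card Q) powr (1 + \<epsilon>)" for Q
    let ?F = "Pow P - {{}}"
    have finF: "finite (r ` ?F)" "r ` ?F \<noteq> {}" using P by auto
    obtain Q where Q: "Max (r ` ?F) = r Q" "Q \<in> ?F" using Max_in[OF finF] by (rule imageE)
    have rmax: "r Q' \<le> r Q" if "Q' \<subseteq> P" "Q' \<noteq> {}" for Q'
      unfolding Q(1)[symmetric] using that finF(1) by (intro Max_ge) auto
    have finQ: "finite Q" and Q0: "Q \<noteq> {}" and QP: "Q \<subseteq> P" using Q(2) P(1) finite_subset by auto
    define m where "m = card Q"
    define e where "e = card (ind Q)"
    have m1: "m \<ge> 1" using finQ Q0 by (simp add: m_def Suc_le_eq card_gt_0_iff)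
    have "ind P = E" using P(3) by (auto simp: ind_def)
    moreover have "card P > 0" using P by (simp add: card_gt_0_iff)
    ultimately have "C \<le> r P" using dense by (simp add: r_def le_divide_eq)
    also have "r P \<le> r Q" using rmax[of P] P(2) by simp
    finally have CrQ: "C \<le> r Q" .
    have e_eq: "real e = r Q * real m powr (1 + \<epsilon>)"
      using m1 by (simp add: r_def e_def m_def)
    have Cpos: "C > 0" using C q by linarith
    have rpos: "r Q > 0" using CrQ Cpos by simp
    have epos: "real e > 0" unfolding e_eq using rpos m1 by simp
    have eC: "C * real m powr (1 + \<epsilon>) \<le> real e" unfolding e_eq using CrQ by (intro mult_right_mono) auto
    have finind: "finite (ind Q)" using finQ by (auto simp: ind_def)
    have "e \<le> card (Q \<times> Q)" unfolding e_def ind_def using finQ by (intro card_mono) auto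
    then have "real e \<le> real m * real m" by (simp add: m_def card_cartesian_product flip: of_nat_mult)
    \<comment> \<open>Density together with \<open>e \<le> m * m\<close> gives
      \<open>C \<le> m\<close>. This is needed to absorb a rounding term \<open>1\<close> into
      \<open>m / q\<close>.\<close>
    have qm: "real q \<le> real m"
    proof -
      have "C * real m \<le> C * real m powr (1 + \<epsilon>)"
        using powr_mono[of 1 "1 + \<epsilon>" "real m"] m1 \<epsilon> Cpos by simp
      also have "\<dots> \<le> real m * real m" using eC \<open>real e \<le> real m * real m\<close> by linarith
      finally have "C \<le> real m" using m1 by simp
      then show ?thesis using C q by linarith
    qed
    define deg where "deg v = card {x \<in> ind Q. fst x = v \<or> snd x = v}" for v
    \<comment> \<open>The degrees sum to at most \<open>2 * e\<close>, so at most
      \<open>m / q\<close> vertices exceed this threshold.\<close>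
    define D where "D = 2 * real q * real e / real m"
    have Dpos: "D > 0" unfolding D_def using q epos m1 by simp
    define T where "T = {v \<in> Q. real (deg v) > D}"
    have finT: "finite T" and TQ: "T \<subseteq> Q" using finQ by (auto simp: T_def)
    have "real (card T) * D \<le> (\<Sum>v\<in>T. real (deg v))"
      using sum_bounded_below[of T D "\<lambda>v. real (deg v)"] by (auto simp: T_def less_imp_le)
    also have "\<dots> \<le> (\<Sum>v\<in>Q. real (deg v))" using finQ TQ by (intro sum_mono2) auto
    also have "\<dots> \<le> 2 * real e"
      using sum_degree_le[OF finQ, of "ind Q"] unfolding deg_def e_def
      by (simp add: ind_def flip: of_nat_sum)
    finally have "real (card T) * (real q * real e) \<le> real m * real e"
      using m1 by (simp add: D_def field_simps)
    then have cT: "real (card T) * real q \<le> real m" using epos by (simp add: mult.assoc[symmetric])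
    define ET where "ET = {x \<in> ind Q. fst x \<in> T \<or> snd x \<in> T}"
    have "2 * card ET \<le> e"
    proof -
      \<comment> \<open>Block size: \<open>q\<close> blocks cover \<open>Q\<close>, and
        \<open>T\<close> with one block has at most \<open>m / q + m / q + 1 \<le> 3 * m / q\<close>
        vertices.\<close>
      define k where "k = m div q + 1"
      have k0: "k > 0" by (simp add: k_def)
      have mqk: "m < q * k" using q(1) unfolding k_def
        by (metis add.commute dividend_less_times_div less_le_trans plus_1_eq_Suc mult_Suc_right zero_less_one order_refl)
      obtain h where h: "bij_betw h Q {0..<m}" using ex_bij_betw_finite_nat[OF finQ] m_def by blast
      define B where "B j = {v \<in> Q. h v div k = j}" for j
      have cB: "card (B j) \<le> k" for j
      proof -
        have "h ` B j \<subseteq> {j * k..<j * k + k}"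
        proof
          fix i assume "i \<in> h ` B j"
          then have "i div k = j" by (auto simp: B_def)
          then show "i \<in> {j * k..<j * k + k}"
            using dividend_less_div_times[OF k0, of i] by auto
        qed
        then have "card (h ` B j) \<le> k" using card_mono[of "{j * k..<j * k + k}"] by fastforce
        moreover have "inj_on h (B j)" using h by (auto simp: bij_betw_def B_def intro: inj_on_subset)
        ultimately show ?thesis by (simp add: card_image)
      qed
      have cov: "\<exists>j<q. v \<in> B j" if "v \<in> Q" for v
      proof (intro exI conjI)
        have "h v < m" using h that by (auto simp: bij_betw_def)
        then have "h v < q * k" using mqk by simp
        then show "h v div k < q" by (simp add: less_mult_imp_div_less)
        show "v \<in> B (h v div k)" using that by (simp add: B_def)
      qed
      \<comment> \<open>An edge meeting \<open>T\<close> has one end in \<open>T\<close> and the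
        other in some block.\<close>
      have "ET \<subseteq> (\<Union>j<q. ind (T \<union> B j))"
      proof
        fix x assume x: "x \<in> ET"
        then obtain j1 j2 where "j1 < q" "fst x \<in> B j1" "j2 < q" "snd x \<in> B j2"
          using cov[of "fst x"] cov[of "snd x"] by (auto simp: ET_def ind_def)
        then show "x \<in> (\<Union>j<q. ind (T \<union> B j))"
          using x by (cases x) (auto simp: ET_def ind_def)
      qed
      moreover have finTB: "finite (T \<union> B j)" for j using finT finQ by (auto simp: B_def)
      ultimately have "card ET \<le> card (\<Union>j<q. ind (T \<union> B j))"
        by (intro card_mono) (auto simp: ind_def)
      also have "\<dots> \<le> (\<Sum>j<q. card (ind (T \<union> B j)))" by (rule card_UN_le) simp
      finally have "real (card ET) \<le> (\<Sum>j<q. real (card (ind (T \<union> B j))))"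
        by (simp flip: of_nat_sum)
      also have "\<dots> \<le> (\<Sum>j<q. r Q * (3 * real m / real q) powr (1 + \<epsilon>))"
      proof (rule sum_mono)
        fix j
        show "real (card (ind (T \<union> B j))) \<le> r Q * (3 * real m / real q) powr (1 + \<epsilon>)"
        proof (cases "T \<union> B j = {}")
          case True
          then show ?thesis using rpos by (simp add: ind_def)
        next
          case False
          have "real (card (T \<union> B j)) \<le> real (card T) + real k"
            using card_Un_le[of T "B j"] cB[of j] by linarith
          also have "real k \<le> real m / real q + 1"
          proof -
            have "real (m div q * q) \<le> real m" by (simp only: of_nat_le_iff div_times_less_eq_dividend)
            then show ?thesis using q(1) by (simp add: k_def le_divide_eq)
          qed
          also have "real (card T) + (real m / real q + 1) \<le> 3 * real m / real q"
          proof -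
            have "real (card T) \<le> real m / real q" "1 \<le> real m / real q"
              using cT qm q(1) by (simp_all add: le_divide_eq)
            then show ?thesis unfolding times_divide_eq_right[symmetric] by linarith
          qed
          finally have le: "real (card (T \<union> B j)) \<le> 3 * real m / real q" by simp
          have c0: "card (T \<union> B j) > 0" using False finTB[of j] by (simp only: card_gt_0_iff) simp
          have "r (T \<union> B j) \<le> r Q" using False QP TQ by (intro rmax) (auto simp: B_def)
          then have "real (card (ind (T \<union> B j))) \<le> r Q * real (card (T \<union> B j)) powr (1 + \<epsilon>)"
            using c0 by (simp add: r_def[of "T \<union> B j"] divide_le_eq)
          also have "\<dots> \<le> r Q * (3 * real m / real q) powr (1 + \<epsilon>)"
            using le rpos \<epsilon> by (intro mult_left_mono powr_mono2) auto
          finally show ?thesis .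
        qed
      qed
      also have "\<dots> = real q * (r Q * (3 * real m / real q) powr (1 + \<epsilon>))" by simp
      also have "(3 * real m / real q) powr (1 + \<epsilon>) =
          3 powr (1 + \<epsilon>) * real m powr (1 + \<epsilon>) / (real q * real q powr \<epsilon>)"
        using q(1) by (simp add: powr_divide powr_mult powr_add)
      also have "real q * (r Q * (3 powr (1 + \<epsilon>) * real m powr (1 + \<epsilon>) / (real q * real q powr \<epsilon>))) =
          real e * 3 powr (1 + \<epsilon>) / real q powr \<epsilon>"
        unfolding e_eq using q(1) by simp
      also have "\<dots> \<le> real e * 9 / 18"
      proof (rule frac_le)
        have "(3::real) powr (1 + \<epsilon>) \<le> 3 powr 2" using \<epsilon> by (intro powr_mono) auto
        then show "real e * 3 powr (1 + \<epsilon>) \<le> real e * 9" by (intro mult_left_mono) auto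
      qed (use q18 in auto)
      finally show ?thesis by linarith
    qed
    define E' where "E' = ind Q - ET"
    have ETs: "ET \<subseteq> ind Q" by (auto simp: ET_def)
    then have "card E' = e - card ET" unfolding E'_def e_def using finind
      by (intro card_Diff_subset) (auto intro: finite_subset)
    then have E': "real e / 2 \<le> real (card E')" using \<open>2 * card ET \<le> e\<close> by linarith
    have "real (card {x \<in> E'. fst x = v \<or> snd x = v}) \<le> 4 * real q * real (card E') / real (card Q)" for v
    proof -
      have "real (card {x \<in> E'. fst x = v \<or> snd x = v}) \<le> D"
      proof (cases "v \<in> Q - T")
        case True
        have "card {x \<in> E'. fst x = v \<or> snd x = v} \<le> deg v"
          unfolding deg_def using finind by (intro card_mono) (auto simp: E'_def)
        then have "real (card {x \<in> E'. fst x = v \<or> snd x = v}) \<le> real (deg v)" by simp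
        also have "\<dots> \<le> D" using True by (auto simp: T_def)
        finally show ?thesis .
      next
        case False
        then have "{x \<in> E'. fst x = v \<or> snd x = v} = {}" by (auto simp: E'_def ET_def ind_def)
        then show ?thesis using Dpos by (simp only: card.empty of_nat_0 less_imp_le)
      qed
      \<comment> \<open>The threshold doubles because \<open>E'\<close> is only known to retain half
        of the \<open>e\<close> edges.\<close>
      also have "D \<le> 4 * real q * real (card E') / real (card Q)"
        unfolding D_def m_def[symmetric]
        using mult_left_mono[OF E', of "4 * real q"] by (intro divide_right_mono) auto
      finally show ?thesis .
    qed
    moreover have "C / 2 * real (card Q) powr (1 + \<epsilon>) \<le> real (card E')"
      using E' eC by (simp add: m_def)
    ultimately show "\<exists>Q E'. Q \<subseteq> P \<and> Q \<noteq> {} \<and> E' \<subseteq> E \<and> E' \<subseteq> Q \<times> Q \<and>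
        C / 2 * real (card Q) powr (1 + \<epsilon>) \<le> real (card E') \<and>
        (\<forall>v. real (card {e \<in> E'. fst e = v \<or> snd e = v}) \<le> 4 * real q * real (card E') / real (card Q))"
      using QP Q0 by (intro exI[of _ Q] exI[of _ E']) (auto simp: E'_def ind_def)
  qed
qed

section \<open>The extremal number\<close>

lemma ugraph_iso_sym:
  assumes "ugraph_iso G H" "\<And>e. e \<in> edges G \<Longrightarrow> e \<subseteq> verts G"
  shows "ugraph_iso H G"
proof -
  obtain f where f: "bij_betw f (verts G) (verts H)" "edges H = (\<lambda>e. f ` e) ` edges G"
    using assms(1) unfolding ugraph_iso_def by blast
  let ?g = "inv_into (verts G) f"
  have "?g ` f ` e = e" if "e \<in> edges G" for e
    using f(1) assms(2)[OF that] by (simp add: bij_betw_def inv_into_image_cancel)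
  then have "edges G = (\<lambda>e. ?g ` e) ` edges H" unfolding f(2) by (simp add: image_image)
  then show ?thesis using bij_betw_inv_into[OF f(1)] unfolding ugraph_iso_def by blast
qed

lemma ugraph_iso_trans:
  assumes "ugraph_iso G H" "ugraph_iso H F"
  shows "ugraph_iso G F"
proof -
  obtain f where f: "bij_betw f (verts G) (verts H)" "edges H = (\<lambda>e. f ` e) ` edges G"
    using assms(1) unfolding ugraph_iso_def by blast
  obtain g where g: "bij_betw g (verts H) (verts F)" "edges F = (\<lambda>e. g ` e) ` edges H"
    using assms(2) unfolding ugraph_iso_def by blast
  show ?thesis unfolding ugraph_iso_def
    using bij_betw_trans[OF f(1) g(1)] f(2) g(2)
    by (intro exI[of _ "g \<circ> f"]) (simp add: image_image image_comp)
qed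

lemma ugraph_iso_card:
  assumes "ugraph_iso G H" "is_ugraph G"
  shows "card (verts H) = card (verts G)" "card (edges H) = card (edges G)"
proof -
  obtain f where f: "bij_betw f (verts G) (verts H)" "edges H = (\<lambda>e. f ` e) ` edges G"
    using assms(1) unfolding ugraph_iso_def by blast
  show "card (verts H) = card (verts G)" using bij_betw_same_card[OF f(1)] by simp
  have "edges G \<subseteq> Pow (verts G)" using assms(2) by (auto simp: is_ugraph_def nsets_def)
  then have "inj_on ((`) f) (edges G)"
    using f(1) by (meson bij_betw_def inj_on_image_Pow inj_on_subset)
  then show "card (edges H) = card (edges G)" unfolding f(2) by (rule card_image)
qed

lemma ugraph_edges_le:
  assumes "is_ugraph G"
  shows "card (edges G) \<le> card (verts G) ^ 2"
proof -
  have fin: "finite (verts G \<times> verts G)" using assms by (simp add: is_ugraph_def)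
  have "edges G \<subseteq> (\<lambda>(a, b). {a, b}) ` (verts G \<times> verts G)"
  proof
    fix e assume "e \<in> edges G"
    then have "e \<subseteq> verts G" "card e = 2" using assms by (auto simp: is_ugraph_def nsets_def)
    then obtain a b where "e = {a, b}" "a \<in> verts G" "b \<in> verts G" by (auto simp: card_2_iff)
    then show "e \<in> (\<lambda>(a, b). {a, b}) ` (verts G \<times> verts G)" by (intro image_eqI[of _ _ "(a, b)"]) auto
  qed
  then have "card (edges G) \<le> card ((\<lambda>(a, b). {a, b}) ` (verts G \<times> verts G))"
    by (rule card_mono[rotated]) (rule finite_imageI[OF fin])
  also have "\<dots> \<le> card (verts G \<times> verts G)" by (rule card_image_le[OF fin])
  finally show ?thesis by (simp add: card_cartesian_product power2_eq_square)
qed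

text \<open>\<open>ex\<close> is a \<open>Max\<close>, so the set behind it must be finite, by the
  quadratic bound on edges, and nonempty, by the edgeless graph.\<close>

lemma ex_le:
  fixes H :: "'v ugraph"
  assumes "edges H \<noteq> {}"
    and bound: "\<And>G :: nat ugraph. is_ugraph G \<Longrightarrow> card (verts G) = n \<Longrightarrow> \<not> contains_copy G H \<Longrightarrow>
      real (card (edges G)) \<le> B"
  shows "real (ex n H) \<le> B"
proof -
  let ?A = "{card (edges G) | G :: nat ugraph. is_ugraph G \<and> card (verts G) = n \<and> \<not> contains_copy G H}"
  have "?A \<subseteq> {..n ^ 2}" using ugraph_edges_le by auto
  then have fin: "finite ?A" by (rule finite_subset) simp
  let ?G = "\<lparr>verts = {..<n}, edges = {}\<rparr> :: nat ugraph"
  have "\<not> contains_copy ?G H"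
    using assms(1) by (auto simp: contains_copy_def subgraph_def ugraph_iso_def)
  moreover have "is_ugraph ?G" "card (verts ?G) = n" by (auto simp: is_ugraph_def)
  ultimately have "card (edges ?G) \<in> ?A" by blast
  then have "ex n H \<in> ?A" unfolding ex_def using fin by (intro Max_in) auto
  then show ?thesis using bound by auto
qed

lemma bigo_ex:
  fixes H :: "'v ugraph"
  assumes "edges H \<noteq> {}"
    and bound: "\<And>G :: nat ugraph. is_ugraph G \<Longrightarrow> verts G \<noteq> {} \<Longrightarrow> \<not> contains_copy G H \<Longrightarrow>
      real (card (edges G)) \<le> B * real (card (verts G)) powr p"
  shows "(\<lambda>n. real (ex n H)) \<in> O(\<lambda>n. real n powr p)"
proof (rule bigoI[where c = B])
  show "\<forall>\<^sub>F n in sequentially. norm (real (ex n H)) \<le> B * norm (real n powr p)"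
    using eventually_ge_at_top[of 1]
  proof eventually_elim
    case (elim n)
    have "real (ex n H) \<le> B * real n powr p"
    proof (rule ex_le[OF assms(1)])
      fix G :: "nat ugraph" assume G: "is_ugraph G" "card (verts G) = n" "\<not> contains_copy G H"
      then have "verts G \<noteq> {}" using elim by auto
      then show "real (card (edges G)) \<le> B * real n powr p" using bound[of G] G by simp
    qed
    then show ?case by simp
  qed
qed

text \<open>The counting bounds \<open>m\<^sup>v (d / m)\<^sup>e \<le> hom \<le> A m (K d)\<^sup>t\<close> cap the average degree \<open>d\<close> by a
  constant multiple of \<open>m\<close> to the power \<open>(e - v + 1) / (e - t)\<close>.\<close>

lemma average_degree_bound:
  fixes m d K A C :: real and v e t :: nat
  assumes m: "m \<ge> 1" and d: "d > 0" and te: "t < e" and C: "C \<ge> 0"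
    and count: "m ^ v * (d / m) ^ e \<le> A * (m * (K * d) ^ t)"
    and dense: "C * m powr ((real e - real v + 1) / (real e - real t)) \<le> d"
  shows "C ^ (e - t) \<le> A * K ^ t"
proof -
  have et: "e = (e - t) + t" using te by simp
  have "m ^ v * d ^ e = m ^ v * (d / m) ^ e * m ^ e" using m by (simp add: power_divide)
  also have "\<dots> \<le> A * (m * (K * d) ^ t) * m ^ e" using count m by (intro mult_right_mono) auto
  finally have "m ^ v * (d ^ (e - t) * d ^ t) \<le> A * K ^ t * (m * m ^ e) * d ^ t"
    by (subst (asm) et, subst (asm) power_add) (simp add: power_mult_distrib mult_ac)
  then have 1: "m ^ v * d ^ (e - t) \<le> A * K ^ t * m ^ (e + 1)"
    using d by (simp add: mult.assoc[symmetric])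
  have "(C * m powr ((real e - real v + 1) / (real e - real t))) ^ (e - t) \<le> d ^ (e - t)"
    using dense C by (intro power_mono) auto
  moreover have "(m powr ((real e - real v + 1) / (real e - real t))) ^ (e - t) = m powr (real e - real v + 1)"
  proof -
    have "(m powr ((real e - real v + 1) / (real e - real t))) ^ (e - t) =
        m powr ((real e - real v + 1) / (real e - real t) * real (e - t))"
      using m by (simp add: powr_realpow[symmetric] powr_powr)
    also have "(real e - real v + 1) / (real e - real t) * real (e - t) = real e - real v + 1"
      using te by (simp add: of_nat_diff)
    finally show ?thesis .
  qed
  ultimately have "C ^ (e - t) * m powr (real e - real v + 1) \<le> d ^ (e - t)"
    by (simp add: power_mult_distrib)
  then have 2: "m ^ v * (C ^ (e - t) * m powr (real e - real v + 1)) \<le> m ^ v * d ^ (e - t)"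
    using m by (intro mult_left_mono) auto
  have eq: "m ^ v * m powr (real e - real v + 1) = m ^ (e + 1)"
  proof -
    have "m ^ v * m powr (real e - real v + 1) = m powr real v * m powr (real e - real v + 1)"
      using m by (simp add: powr_realpow)
    also have "\<dots> = m powr real (e + 1)" by (simp add: add.commute flip: powr_add)
    also have "\<dots> = m ^ (e + 1)" using m by (subst powr_realpow) auto
    finally show ?thesis .
  qed
  have "C ^ (e - t) * m ^ (e + 1) = m ^ v * (C ^ (e - t) * m powr (real e - real v + 1))"
    unfolding eq[symmetric] by (simp only: mult_ac)
  also have "\<dots> \<le> A * K ^ t * m ^ (e + 1)" using 2 1 by (rule order_trans)
  finally have "C ^ (e - t) * m ^ (e + 1) \<le> A * K ^ t * m ^ (e + 1)" .
  then show ?thesis using m by simp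
qed

section \<open>Size and degrees of the coset graph, and the density bound for hosts without a
  copy\<close>

context parabolic_pair
begin

definition H0 :: "('a set + 'a set) ugraph" where
  "H0 = coxeter_graph G I J"

lemma verts_H0: "verts H0 = V"
  by (simp add: H0_def coxeter_graph_def V_def)

lemma edges_H0: "edges H0 = (\<lambda>w. {Inl (coset I w), Inr (coset J w)}) ` carrier G"
  by (auto simp: H0_def coxeter_graph_def coset_def)

lemma K_subgroup: "subgroup K G"
  using parabolic_subgroup[OF I] parabolic_subgroup[OF J] by (rule subgroups_Inter_pair)

text \<open>The tags exclude swapping ends, so two labels give the same edge iff they agree in both
  cosets, i.e. modulo \<open>K\<close>. Edges thus correspond to cosets of \<open>K\<close>, and
  Lagrange's theorem applies.\<close>

lemma card_edges_H0: "card (edges H0) * card K = card (carrier G)"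
proof -
  \<comment> \<open>Functions that identify the same points of \<open>A\<close> have equinumerous
    images.\<close>
  have same: "card (f ` A) = card (g ` A)" if "\<And>x y. x \<in> A \<Longrightarrow> y \<in> A \<Longrightarrow> f x = f y \<longleftrightarrow> g x = g y"
    for f :: "'a \<Rightarrow> 'p" and g :: "'a \<Rightarrow> 'q" and A
  proof (rule bij_betw_same_card)
    show "bij_betw (\<lambda>p. g (inv_into A f p)) (f ` A) (g ` A)"
    proof (rule bij_betwI')
      fix p q assume "p \<in> f ` A" "q \<in> f ` A"
      then show "(g (inv_into A f p) = g (inv_into A f q)) = (p = q)"
        using that by (metis f_inv_into_f inv_into_into)
    next
      fix p assume "p \<in> f ` A"
      then show "g (inv_into A f p) \<in> g ` A" by (simp add: inv_into_into)
    next
      fix p assume "p \<in> g ` A"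
      then obtain x where x: "x \<in> A" "p = g x" by auto
      then have "p = g (inv_into A f (f x))" using that by (metis f_inv_into_f imageI inv_into_into)
      then show "\<exists>q \<in> f ` A. p = g (inv_into A f q)" using x by blast
    qed
  qed
  have "card (edges H0) = card ((\<lambda>w. w <# K) ` carrier G)"
    unfolding edges_H0
  proof (rule same)
    fix v w assume vw: "v \<in> carrier G" "w \<in> carrier G"
    have "{Inl (coset I v), Inr (coset J v)} = {Inl (coset I w), Inr (coset J w)} \<longleftrightarrow>
      coset I v = coset I w \<and> coset J v = coset J w" by (auto simp: doubleton_eq_iff)
    then show "({Inl (coset I v), Inr (coset J v)} = {Inl (coset I w), Inr (coset J w)}) = (v <# K = w <# K)"
      using coset_eq_iff[OF I vw] coset_eq_iff[OF J vw] l_coset_eq_iff[OF K_subgroup vw] by simp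
  qed
  also have "(\<lambda>w. w <# K) ` carrier G = lcosets K" by (auto simp: LCOSETS_def)
  finally show ?thesis using l_lagrange[OF fin K_subgroup] by (simp add: order_def)
qed

lemma is_ugraph_H0: "is_ugraph H0"
  using V_I V_J by (auto simp: is_ugraph_def verts_H0 edges_H0 nsets_def)

lemma contains_copyI:
  fixes \<Gamma> :: "'z ugraph"
  assumes \<Gamma>: "is_ugraph \<Gamma>" and f: "inj_on f V" "f ` V \<subseteq> verts \<Gamma>" "edges_ok E (carrier G) f"
    and E: "\<And>u v. (u, v) \<in> E \<Longrightarrow> {u, v} \<in> edges \<Gamma>"
    and H: "ugraph_iso H H0" "is_ugraph H"
  shows "contains_copy \<Gamma> H"
proof -
  let ?F = "\<lparr>verts = f ` V, edges = (\<lambda>e. f ` e) ` edges H0\<rparr>"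
  have sub: "edges ?F \<subseteq> edges \<Gamma>"
    using f(3) E by (auto simp: edges_H0 edges_ok_def)
  moreover have "e \<subseteq> f ` V" if "e \<in> edges ?F" for e
    using that is_ugraph_H0 by (auto simp: is_ugraph_def nsets_def verts_H0)
  ultimately have "is_ugraph ?F"
    using \<Gamma> by (auto simp: is_ugraph_def nsets_def subset_iff)
  then have "subgraph ?F \<Gamma>" using sub f(2) by (simp add: subgraph_def)
  moreover have "ugraph_iso H0 ?F"
    unfolding ugraph_iso_def using f(1) by (intro exI[of _ f]) (simp add: verts_H0 bij_betw_def)
  then have "ugraph_iso H ?F" by (rule ugraph_iso_trans[OF H(1)])
  then have "ugraph_iso ?F H"
    by (rule ugraph_iso_sym) (use H(2) in \<open>auto simp: is_ugraph_def nsets_def\<close>)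
  ultimately show ?thesis unfolding contains_copy_def by blast
qed

text \<open>As \<open>s\<close> is outside the second parabolic subgroup, the intersection and its
  translate by \<open>s\<close> are disjoint, and both lie in the first.\<close>

lemma card_parabolic_ge:
  assumes L: "L \<subseteq> S" "s \<in> L" and M: "M \<subseteq> S" "s \<notin> M"
  shows "2 * card (generate G L \<inter> generate G M) \<le> card (generate G L)"
proof -
  let ?N = "generate G L \<inter> generate G M"
  have sub: "subgroup (generate G L) G" "subgroup (generate G M) G"
    using parabolic_subgroup L M by auto
  have s: "s \<in> S" "s \<in> generate G L" using L by (auto intro: generate.incl)
  have NG: "?N \<subseteq> carrier G" using parabolic_carrier[OF L(1)] by auto
  have finN: "finite ?N" "finite (generate G L)" using parabolic_carrier[OF L(1)] fin NG finite_subset by auto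
  have "s \<otimes> x \<notin> ?N" if x: "x \<in> ?N" for x
  proof
    assume "s \<otimes> x \<in> ?N"
    then have "(s \<otimes> x) \<otimes> inv x \<in> generate G M"
      using x sub(2) by (auto intro: subgroup.m_closed subgroup.m_inv_closed)
    moreover have "(s \<otimes> x) \<otimes> inv x = s" using x NG s by (auto simp: m_assoc)
    ultimately show False using generator_in_generate[OF s(1) M(1)] M(2) by simp
  qed
  then have "?N \<inter> (\<otimes>) s ` ?N = {}" by auto
  moreover have "card ((\<otimes>) s ` ?N) = card ?N"
    using s NG by (intro card_image inj_on_subset[OF inj_on_cmult]) auto
  ultimately have "card (?N \<union> (\<otimes>) s ` ?N) = 2 * card ?N" using finN by (simp add: card_Un_disjoint)
  moreover have "?N \<union> (\<otimes>) s ` ?N \<subseteq> generate G L"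
    using s(2) sub(1) by (auto intro: subgroup.m_closed)
  ultimately show ?thesis using card_mono[OF finN(2)] by metis
qed

text \<open>All vertices of a part have the same degree, the index of \<open>K\<close> in the
  parabolic subgroup, and this is at least two. Hence \<open>e \<ge> 2 * t\<close>, which keeps the
  final exponent in range.\<close>

lemma card_edges_ge:
  assumes "s \<in> I - J" "t \<in> J - I"
  shows "2 * card (cosets I) \<le> card (edges H0)" "2 * card (cosets J) \<le> card (edges H0)"
proof -
  have *: "2 * card (cosets L) \<le> card (edges H0)"
    if L: "subgroup (generate G L) G" and le: "2 * card K \<le> card (generate G L)" for L
  proof -
    have "card (cosets L) * (2 * card K) \<le> card (cosets L) * card (generate G L)"
      using le by (rule mult_le_mono2)
    also have "\<dots> = card (edges H0) * card K"
      using l_lagrange[OF fin L] card_edges_H0 by (simp add: order_def)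
    finally show ?thesis using card_K_pos by simp
  qed
  show "2 * card (cosets I) \<le> card (edges H0)"
    using assms I J card_parabolic_ge[of I s J] by (intro * parabolic_subgroup) auto
  show "2 * card (cosets J) \<le> card (edges H0)"
    using assms I J card_parabolic_ge[of J t I] by (intro * parabolic_subgroup) (auto simp: Int_commute)
qed

lemma card_V: "card V = card (cosets I) + card (cosets J)"
  unfolding V_def using fin by (intro card_Plus) (simp_all add: cosets_eq)

lemma card_cosets_pos: "card (cosets L) > 0"
  using fin by (auto simp: card_gt_0_iff cosets_eq)

lemma card_edges_bound:
  fixes H :: "'v ugraph"
  assumes SI: "S = insert s0 I" and SJ: "S = insert t0 J"
    and IJ: "s \<in> I - J" "s' \<in> J - I"
    and H: "ugraph_iso H H0" "is_ugraph H"
    and t: "t = max (card (cosets I)) (card (cosets J))" and e: "e = card (edges H0)"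
    and \<epsilon>: "\<epsilon> = (real e - real (card V) + 1) / (real e - real t)"
  obtains B :: real where
    "\<And>\<Gamma> :: 'z ugraph. is_ugraph \<Gamma> \<Longrightarrow> verts \<Gamma> \<noteq> {} \<Longrightarrow> \<not> contains_copy \<Gamma> H \<Longrightarrow>
      real (card (edges \<Gamma>)) \<le> B * real (card (verts \<Gamma>)) powr (1 + \<epsilon>)"
proof -
  let ?a = "card (cosets I)" and ?b = "card (cosets J)"
  have e2t: "2 * t \<le> e" using card_edges_ge[OF IJ] by (simp add: t e)
  have pos: "?a \<ge> 1" "?b \<ge> 1" using card_cosets_pos[of I] card_cosets_pos[of J] by linarith+
  then have te: "t < e" using e2t unfolding t by linarith
  have Vt: "t + 1 \<le> card V" "card V \<le> 2 * t" using pos unfolding card_V t by linarith+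
  \<comment> \<open>The numerator \<open>e - v + 1\<close> is positive since
    \<open>v \<le> 2 * t \<le> e\<close>, and at most \<open>e - t\<close> since
    \<open>t + 1 \<le> v\<close>.\<close>
  have \<epsilon>01: "0 < \<epsilon>" "\<epsilon> \<le> 1" using Vt te e2t unfolding \<epsilon> by (simp_all add: divide_le_eq)
  obtain A :: nat where A: "\<forall>(Z :: 'z set) E X Y. finite Z \<longrightarrow> E \<subseteq> X \<times> Y \<longrightarrow> X \<inter> Y = {} \<longrightarrow>
      (\<forall>f \<in> V \<rightarrow>\<^sub>E Z. inj_on f V \<longrightarrow> \<not> edges_ok E (carrier G) f) \<longrightarrow>
      homs Z E \<le> A * max (mono_homs Z E (Inl ` cosets I)) (mono_homs Z E (Inr ` cosets J))"
    using homs_upper[where ?'z = 'z, OF SI SJ] by (rule exE)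
  obtain k :: real where k: "k \<ge> 1" and
    reg: "\<forall>(E :: ('z \<times> 'z) set) P C. finite P \<longrightarrow> P \<noteq> {} \<longrightarrow> E \<subseteq> P \<times> P \<longrightarrow> C \<ge> k \<longrightarrow>
      C * real (card P) powr (1 + \<epsilon>) \<le> real (card E) \<longrightarrow>
      (\<exists>Q E'. Q \<subseteq> P \<and> Q \<noteq> {} \<and> E' \<subseteq> E \<and> E' \<subseteq> Q \<times> Q \<and>
        C / 2 * real (card Q) powr (1 + \<epsilon>) \<le> real (card E') \<and>
        (\<forall>v. real (card {e \<in> E'. fst e = v \<or> snd e = v}) \<le> k * real (card E') / real (card Q)))"
    using almost_regular_subgraph[where ?'v = 'z, OF \<epsilon>01] by (elim exE conjE)
  \<comment> \<open>\<open>C\<close> must pass the threshold \<open>k\<close> of the regularisation,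
    and \<open>C / 2\<close> must exceed the cap \<open>A * k ^ t\<close> that
    \<open>average_degree_bound\<close> puts on \<open>(C / 2) ^ (e - t)\<close>.\<close>
  define C where "C = max k (2 * (real A * k ^ t + 1))"
  have C: "C \<ge> k" "C / 2 \<ge> real A * k ^ t + 1" by (auto simp: C_def)
  have C1: "C / 2 \<ge> 1"
  proof -
    have "0 \<le> real A * k ^ t" using k by simp
    then show ?thesis using C(2) by linarith
  qed
  \<comment> \<open>The factor \<open>2\<close> in \<open>2 * C\<close> is lost to the cut; the
    regularisation then turns \<open>C\<close> into \<open>C / 2\<close>.\<close>
  show thesis
  proof (rule that[of "2 * C"], rule ccontr)
    fix \<Gamma> :: "'z ugraph"
    assume \<Gamma>: "is_ugraph \<Gamma>" "verts \<Gamma> \<noteq> {}" and free: "\<not> contains_copy \<Gamma> H"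
      and "\<not> real (card (edges \<Gamma>)) \<le> 2 * C * real (card (verts \<Gamma>)) powr (1 + \<epsilon>)"
    then have many: "2 * C * real (card (verts \<Gamma>)) powr (1 + \<epsilon>) < real (card (edges \<Gamma>))" by simp
    have finV: "finite (verts \<Gamma>)" and ed: "edges \<Gamma> \<subseteq> [verts \<Gamma>]\<^bsup>2\<^esup>" using \<Gamma>(1) by (auto simp: is_ugraph_def)
    obtain X where X: "X \<subseteq> verts \<Gamma>"
      "card (edges \<Gamma>) \<le> 2 * card {(u, v). u \<in> X \<and> v \<in> verts \<Gamma> - X \<and> {u, v} \<in> edges \<Gamma>}"
      using max_cut[OF finV ed] by blast
    define E where "E = {(u, v). u \<in> X \<and> v \<in> verts \<Gamma> - X \<and> {u, v} \<in> edges \<Gamma>}"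
    have "real (card (edges \<Gamma>)) \<le> 2 * real (card E)" using X(2) unfolding E_def by linarith
    then have "C * real (card (verts \<Gamma>)) powr (1 + \<epsilon>) \<le> real (card E)" using many by linarith
    moreover have "E \<subseteq> verts \<Gamma> \<times> verts \<Gamma>" using X(1) by (auto simp: E_def)
    ultimately have "\<exists>Q E'. Q \<subseteq> verts \<Gamma> \<and> Q \<noteq> {} \<and> E' \<subseteq> E \<and> E' \<subseteq> Q \<times> Q \<and>
        C / 2 * real (card Q) powr (1 + \<epsilon>) \<le> real (card E') \<and>
        (\<forall>v. real (card {e \<in> E'. fst e = v \<or> snd e = v}) \<le> k * real (card E') / real (card Q))"
      by (intro reg[rule_format, OF finV \<Gamma>(2) _ C(1)])
    then obtain Q E' where Q: "Q \<subseteq> verts \<Gamma>" "Q \<noteq> {}" and E': "E' \<subseteq> E" "E' \<subseteq> Q \<times> Q"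
      "C / 2 * real (card Q) powr (1 + \<epsilon>) \<le> real (card E')"
      and deg: "\<And>v. real (card {e \<in> E'. fst e = v \<or> snd e = v}) \<le> k * real (card E') / real (card Q)"
      by (elim exE conjE) (auto simp del: of_nat_le_iff)
    have finQ: "finite Q" using Q(1) finV finite_subset by blast
    define m where "m = real (card Q)"
    define d where "d = real (card E') / m"
    have m: "m \<ge> 1" using finQ Q(2) by (simp add: m_def Suc_le_eq card_gt_0_iff)
    have "0 < C / 2 * m powr (1 + \<epsilon>)" using C1 m by (intro mult_pos_pos) auto
    then have E'pos: "real (card E') > 0" using E'(3) unfolding m_def by linarith
    have d: "d > 0" using E'pos m by (simp add: d_def)
    have dense: "C / 2 * m powr \<epsilon> \<le> d"
      using E'(3) m unfolding d_def m_def[symmetric] by (simp add: powr_add le_divide_eq mult_ac)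
    have degd: "real (card {e \<in> E'. fst e = v \<or> snd e = v}) \<le> k * d" for v
      using deg[of v] by (simp add: d_def m_def)
    have finE': "finite E'" using E'(2) finQ by (meson finite_SigmaI finite_subset)
    define D where "D = nat \<lfloor>k * d\<rfloor>"
    have degD: "card {y. (u, y) \<in> E'} \<le> D" "card {y. (y, u) \<in> E'} \<le> D" for u
    proof -
      let ?N = "{e \<in> E'. fst e = u \<or> snd e = u}"
      have "card ?N \<le> D" unfolding D_def using degd[of u] by (rule le_nat_floor)
      moreover have "card {y. (u, y) \<in> E'} \<le> card ?N"
        using finE' by (intro card_inj_on_le[where f = "\<lambda>y. (u, y)"]) (auto simp: inj_on_def)
      moreover have "card {y. (y, u) \<in> E'} \<le> card ?N"
        using finE' by (intro card_inj_on_le[where f = "\<lambda>y. (y, u)"]) (auto simp: inj_on_def)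
      ultimately show "card {y. (u, y) \<in> E'} \<le> D" "card {y. (y, u) \<in> E'} \<le> D" by linarith+
    qed
    have Dkd: "real D \<le> k * d" unfolding D_def using k d by (simp add: of_nat_nat)
    \<comment> \<open>The two parts may differ in size; raising the exponent of the smaller one to
      \<open>t\<close> needs a base of at least \<open>1\<close>. The end of any pair of
      \<open>E'\<close> has degree at least one.\<close>
    have kd1: "1 \<le> k * d"
    proof -
      obtain x where x: "x \<in> E'" using E'pos by (metis card.empty equals0I of_nat_0 less_irrefl)
      then have "{e \<in> E'. fst e = fst x \<or> snd e = fst x} \<noteq> {}" by blast
      then have "card {e \<in> E'. fst e = fst x \<or> snd e = fst x} > 0" using finE' by (subst card_gt_0_iff) simp
      then show ?thesis using degd[of "fst x"] by linarith
    qed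
    have part: "real (card Q * D ^ j) \<le> m * (k * d) ^ t" if "j \<le> t" for j
    proof -
      have "real D ^ j \<le> (k * d) ^ j" using Dkd by (intro power_mono) auto
      also have "\<dots> \<le> (k * d) ^ t" using kd1 that by (intro power_increasing)
      finally show ?thesis using m by (simp add: m_def)
    qed
    have "homs Q E' \<le> A * max (mono_homs Q E' (Inl ` cosets I)) (mono_homs Q E' (Inr ` cosets J))"
    proof (rule A[rule_format, OF finQ])
      show "E' \<subseteq> X \<times> (verts \<Gamma> - X)" using E'(1) by (auto simp: E_def)
      show "X \<inter> (verts \<Gamma> - X) = {}" by auto
      show "\<not> edges_ok E' (carrier G) f" if f: "f \<in> V \<rightarrow>\<^sub>E Q" "inj_on f V" for f
      proof
        assume "edges_ok E' (carrier G) f"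
        moreover have "f ` V \<subseteq> verts \<Gamma>" using f(1) Q(1) by auto
        ultimately have "contains_copy \<Gamma> H"
          using contains_copyI[OF \<Gamma>(1) f(2) _ _ _ H, of E'] E'(1) by (auto simp: E_def)
        then show False using free by simp
      qed
    qed
    also have "\<dots> \<le> A * max (card Q * D ^ ?b) (card Q * D ^ ?a)"
      using mono_homs_part_le[OF finQ E'(2), of D] degD by (intro mult_le_mono2 max.mono) auto
    finally have "real (homs Q E') \<le> real (A * max (card Q * D ^ ?b) (card Q * D ^ ?a))"
      by (simp only: of_nat_le_iff)
    also have "\<dots> = real A * max (real (card Q * D ^ ?b)) (real (card Q * D ^ ?a))"
      by (simp add: of_nat_max)
    also have "\<dots> \<le> real A * (m * (k * d) ^ t)"
      using part[of ?a] part[of ?b] by (intro mult_left_mono) (auto simp: t)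
    finally have upper: "real (homs Q E') \<le> real A * (m * (k * d) ^ t)" .
    have "E' \<noteq> {}" using E'pos by auto
    then have "m ^ card V * (real (card E') / m\<^sup>2) ^ e \<le> real (homs Q E')"
      unfolding m_def by (intro homs_lower[OF finQ E'(2)]) (simp_all add: e card_edges_H0)
    moreover have "real (card E') / m\<^sup>2 = d / m" by (simp add: d_def power2_eq_square)
    ultimately have "m ^ card V * (d / m) ^ e \<le> real A * (m * (k * d) ^ t)"
      using upper by simp
    then have "(C / 2) ^ (e - t) \<le> real A * k ^ t"
      using dense C1 unfolding \<epsilon> by (intro average_degree_bound[OF m d te]) auto
    moreover have "C / 2 \<le> (C / 2) ^ (e - t)" using C1 te by (intro self_le_power) auto
    ultimately show False using C(2) by linarith
  qed
qed

end

theorem theorem2p1: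
  fixes W :: "('a, 'b) monoid_scheme"
    and S I J :: "'a set"
    and H :: "'v ugraph"
    and t :: nat
    and c :: real
  assumes "finite_coxeter_system W S"
    and "I \<subseteq> S" and "J \<subseteq> S"
    and "card I + 1 = card S" and "card J + 1 = card S"
    and "is_ugraph H"
    and "ugraph_iso H (coxeter_graph W I J)"
    and "t = max (card (lcosets\<^bsub>W\<^esub> (generate W I))) (card (lcosets\<^bsub>W\<^esub> (generate W J)))"
    and "c = (real (card (verts H)) - real t - 1) / (real (card (edges H)) - real t)"
  shows "(\<lambda>n. real (ex n H)) \<in> O(\<lambda>n. real n powr (2 - c))"
proof -
  obtain neg where "coxeter_halves W S neg"
    using finite_coxeter_system_halves[OF assms(1)] by blast
  then interpret coxeter_halves W S neg .
  interpret parabolic_pair W S neg I J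
    by unfold_locales (use assms(2,3) in auto)
  have finS: "finite S" using gens_closed fin finite_subset by blast
  have co1: "\<exists>s. S = insert s L" if L: "L \<subseteq> S" "card L + 1 = card S" for L
  proof -
    have "card (S - L) = 1" using L finS by (simp add: card_Diff_subset finite_subset)
    then obtain s where "S - L = {s}" by (rule card_1_singletonE)
    then show ?thesis using L(1) by blast
  qed
  obtain s0 t0 where ins: "S = insert s0 I" "S = insert t0 J"
    using co1[OF assms(2,4)] co1[OF assms(3,5)] by blast
  have iso: "ugraph_iso H H0" using assms(7) by (simp add: H0_def)
  have cV: "card (verts H) = card V" and cE: "card (edges H) = card (edges H0)"
    using ugraph_iso_card[OF iso assms(6)] by (simp_all add: verts_H0)
  have "card (edges H0) > 0" using card_edges_H0 fin by (metis card_gt_0_iff empty_iff gr0I mult_0 one_closed)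
  then have ne: "edges H \<noteq> {}" using cE by auto
  show ?thesis
  proof (cases "I = J")
    case True
    have "card (edges H0) * card (generate W I) = card (cosets I) * card (generate W I)"
      using card_edges_H0 l_lagrange[OF fin parabolic_subgroup[OF assms(2)]] True by (simp add: order_def)
    then have "card (edges H0) = t" using card_K_pos True assms(8) by simp
    then have "c = 0" using assms(9) cE by simp \<comment> \<open>\<open>H\<close> is a perfect matching and \<open>c = x / 0\<close>\<close>
    moreover have "real (card (edges \<Gamma>)) \<le> 1 * real (card (verts \<Gamma>)) powr 2"
      if "is_ugraph \<Gamma>" "verts \<Gamma> \<noteq> {}" for \<Gamma> :: "nat ugraph"
    proof -
      have "card (verts \<Gamma>) > 0" using that by (simp add: is_ugraph_def card_gt_0_iff)
      then show ?thesis using ugraph_edges_le[OF that(1)] by (simp add: powr_numeral flip: of_nat_power)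
    qed
    ultimately show ?thesis using bigo_ex[OF ne, of 1 2] by simp
  next
    case False
    have "card I = card J" "finite I" "finite J" using assms(2-5) finS finite_subset by auto
    \<comment> \<open>Distinct sets of equal size are incomparable; the generators obtained from
      this make all degrees at least two.\<close>
    then have "\<not> I \<subseteq> J" "\<not> J \<subseteq> I" using False card_subset_eq by metis+
    then obtain s s' where ss: "s \<in> I - J" "s' \<in> J - I" by blast
    define \<epsilon> where "\<epsilon> = (real (card (edges H0)) - real (card V) + 1) / (real (card (edges H0)) - real t)"
    obtain B where B: "\<And>\<Gamma> :: nat ugraph. is_ugraph \<Gamma> \<Longrightarrow> verts \<Gamma> \<noteq> {} \<Longrightarrow> \<not> contains_copy \<Gamma> H \<Longrightarrow>
        real (card (edges \<Gamma>)) \<le> B * real (card (verts \<Gamma>)) powr (1 + \<epsilon>)"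
      using card_edges_bound[OF ins ss iso assms(6,8) HOL.refl \<epsilon>_def] by blast
    have "2 * t \<le> card (edges H0)" "t > 0"
      using card_edges_ge[OF ss] card_cosets_pos[of I] assms(8) by auto
    then have "real (card (edges H0)) - real t \<noteq> 0" by linarith
    then have "2 - c = 1 + \<epsilon>" unfolding assms(9) cV cE \<epsilon>_def by (simp add: field_simps)
    show ?thesis unfolding \<open>2 - c = 1 + \<epsilon>\<close> by (rule bigo_ex[OF ne B])
  qed
qed

end
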